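(* Let $\mathbb{F}$ be an algebraically closed field of characteristic zero, let $V$ be an $\mathbb{F}$-vector space of dimension $6$, and let $\Omega\in\wedge^2V^\ast$ be a non-degenerate form. Let $I_1,I_2\in\mathbb{F}[\wedge^3V^\ast]$ be the two homogeneous polynomial functions of degree $4$ on $\wedge^3V^\ast$ defined in the context. Then the algebra of $Sp(\Omega)$-invariant polynomial functions on $\wedge^3V^\ast$ is generated by $I_1$ and $I_2$: $$\mathbb{F}[\wedge^3V^\ast]^{Sp(\Omega)}=\mathbb{F}[I_1,I_2].$$
   Context: Fix a basis $(v_i)_{i=1}^6$ of $V$ with dual basis $(v^i)_{i=1}^6$ such that $\Omega=\sum_{i=1}^3v^i\wedge v^{i+3}$. Wedge products of covectors are normalized by determinants, e.g. $(v^a\wedge v^b)(x,y)=v^a(x)v^b(y)-v^a(y)v^b(x)$, and $i_v$ denotes insertion of the vector $v$ in the first argument. $Sp(\Omega)\subset GL(V)$ is the group of linear automorphisms preserving $\Omega$. It acts on $\wedge^3V^\ast$ by $(A\cdot\theta)(x,y,z)=\theta(A^{-1}x,A^{-1}y,A^{-1}z)$. $\mathbb{F}[\wedge^3V^\ast]$ is the ring of polynomial functions on $\wedge^3V^\ast$ (a polynomial ring in $20$ variables), and $\mathbb{F}[\wedge^3V^\ast]^{Sp(\Omega)}$ is the subring of those $I$ with $I(A\cdot\theta)=I(\theta)$ for all $\theta\in\wedge^3V^\ast$ and all $A\in Sp(\Omega)$. For $\theta\in\wedge^3V^\ast$, let $J^\theta\in\wedge^2V^\ast\otimes V$ be the unique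 alternating bilinear map $V\times V\to V$ such that $\theta(x,y,z)=\Omega(J^\theta(x,y),z)$ for all $x,y,z\in V$. Definition of $I_1$. Let $v_\theta\in V$ be the unique vector with $i_{v_\theta}(\Omega\wedge\Omega\wedge\Omega)=\theta\wedge\Omega$, and let $L_\theta\colon V\to V$ be the endomorphism $L_\theta(y)=J^\theta(v_\theta,y)$. The characteristic polynomial of $L_\theta$ has the form $\det(xI-L_\theta)=x^6+c_4(\theta)x^4+c_2(\theta)x^2$, with $c_4(\theta)=-\frac{1}{2\cdot 3^2}I_1(\theta)$ and $c_2(\theta)=\frac{1}{2^4\cdot3^4}I_1(\theta)^2$. Thus $I_1(\theta)=-18\,c_4(\theta)$. Definition of $I_2$. Let $J^\theta\barwedge J^\theta\in\wedge^3V^\ast\otimes V$ be defined by $$(J^\theta\barwedge J^\theta)(x_1,x_2,x_3)=J^\theta(J^\theta(x_1,x_2),x_3)+J^\theta(J^\theta(x_2,x_3),x_1)+J^\theta(J^\theta(x_3,x_1),x_2),$$ and let $\xi_{ijk}^l\in\mathbb{F}$ be its components: $(J^\theta\barwedge J^\theta)(v_i,v_j,v_k)=\sum_{l=1}^6\xi_{ijk}^l v_l$. Then $$I_2(\theta)=-\frac13\sum_{l=1}^{3}\ \sum_{\sigma\in S_6}\varepsilon_\sigma\,\xi_{\sigma(1)\sigma(2)\sigma(3)}^{l}\,\xi_{\sigma(4)\sigma(5)\sigma(6)}^{l+3},$$ where $\varepsilon_\sigma$ is the sign of the permutation $\sigma$. *)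

theory Defs
  imports "HOL-Combinatorics.Permutations" "HOL-Library.FuncSet" "Jordan_Normal_Form.Char_Poly"
begin

text \<open>
  Vector spaces are given by a scalar multiplication \<^term>\<open>scale\<close>, as in the locale
  \<^locale>\<open>vector_space\<close>. Bases of the 6-dimensional space are families
  \<open>v 1, ..., v 6\<close> indexed by natural numbers.
\<close>

section \<open>Alternating maps\<close>

definition alternating_bilinear ::
  "('f::field \<Rightarrow> 'v::ab_group_add \<Rightarrow> 'v) \<Rightarrow> ('f \<Rightarrow> 'w::ab_group_add \<Rightarrow> 'w) \<Rightarrow> ('v \<Rightarrow> 'v \<Rightarrow> 'w) \<Rightarrow> bool"
  where "alternating_bilinear s t B \<longleftrightarrow>
    (\<forall>y. Vector_Spaces.linear s t (\<lambda>x. B x y)) \<and>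
    (\<forall>x. Vector_Spaces.linear s t (\<lambda>y. B x y)) \<and>
    (\<forall>x. B x x = 0)"

definition nondegenerate :: "('v::zero \<Rightarrow> 'v \<Rightarrow> 'f::zero) \<Rightarrow> bool"
  where "nondegenerate \<Omega> \<longleftrightarrow> (\<forall>x. (\<forall>y. \<Omega> x y = 0) \<longrightarrow> x = 0)"

definition three_forms ::
  "('f::field \<Rightarrow> 'v::ab_group_add \<Rightarrow> 'v) \<Rightarrow> ('v \<Rightarrow> 'v \<Rightarrow> 'v \<Rightarrow> 'f) set"
  where "three_forms scale = {\<theta>.
    (\<forall>y z. Vector_Spaces.linear scale (*) (\<lambda>x. \<theta> x y z)) \<and>
    (\<forall>x z. Vector_Spaces.linear scale (*) (\<lambda>y. \<theta> x y z)) \<and>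
    (\<forall>x y. Vector_Spaces.linear scale (*) (\<lambda>z. \<theta> x y z)) \<and>
    (\<forall>x y z. x = y \<or> y = z \<or> x = z \<longrightarrow> \<theta> x y z = 0)}"


section \<open>Exterior product and insertion\<close>

text \<open>
  For exterior products, a form of degree \<open>p\<close> is a function of a sequence of vectors
  which depends on the entries \<open>0, ..., p - 1\<close> only.
\<close>

definition form2 :: "('v \<Rightarrow> 'v \<Rightarrow> 'f) \<Rightarrow> (nat \<Rightarrow> 'v) \<Rightarrow> 'f"
  where "form2 \<omega> x = \<omega> (x 0) (x 1)"

definition form3 :: "('v \<Rightarrow> 'v \<Rightarrow> 'v \<Rightarrow> 'f) \<Rightarrow> (nat \<Rightarrow> 'v) \<Rightarrow> 'f"
  where "form3 \<theta> x = \<theta> (x 0) (x 1) (x 2)"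

text \<open>
  The factor \<open>1 / (p! q!)\<close> makes the product of covectors the determinant:
  \<open>(a \<and> b)(x, y) = a(x) b(y) - a(y) b(x)\<close>.
\<close>

definition wedge ::
  "nat \<Rightarrow> nat \<Rightarrow> ((nat \<Rightarrow> 'v) \<Rightarrow> 'f::field_char_0) \<Rightarrow> ((nat \<Rightarrow> 'v) \<Rightarrow> 'f) \<Rightarrow> (nat \<Rightarrow> 'v) \<Rightarrow> 'f"
  where "wedge p q \<alpha> \<beta> x =
    (\<Sum>\<sigma> | \<sigma> permutes {..<p + q}. of_int (sign \<sigma>) * \<alpha> (\<lambda>i. x (\<sigma> i)) * \<beta> (\<lambda>i. x (\<sigma> (p + i))))
      / (fact p * fact q)"

definition insertion :: "'v \<Rightarrow> ((nat \<Rightarrow> 'v) \<Rightarrow> 'f) \<Rightarrow> (nat \<Rightarrow> 'v) \<Rightarrow> 'f"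
  where "insertion u \<alpha> x = \<alpha> (case_nat u x)"


section \<open>Symplectic bases and the symplectic group\<close>

definition dual_basis ::
  "('f::field \<Rightarrow> 'v::ab_group_add \<Rightarrow> 'v) \<Rightarrow> (nat \<Rightarrow> 'v) \<Rightarrow> nat \<Rightarrow> 'v \<Rightarrow> 'f"
  where "dual_basis scale v i x = module.representation scale (v ` {1..6}) x (v i)"

definition symplectic_basis ::
  "('f::field \<Rightarrow> 'v::ab_group_add \<Rightarrow> 'v) \<Rightarrow> ('v \<Rightarrow> 'v \<Rightarrow> 'f) \<Rightarrow> (nat \<Rightarrow> 'v) \<Rightarrow> bool"
  where "symplectic_basis scale \<Omega> v \<longleftrightarrow>
    inj_on v {1..6} \<and> \<not> module.dependent scale (v ` {1..6}) \<and>
    module.span scale (v ` {1..6}) = UNIV \<and>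
    (\<forall>x y. \<Omega> x y = (\<Sum>i = 1..3.
      dual_basis scale v i x * dual_basis scale v (i + 3) y -
      dual_basis scale v i y * dual_basis scale v (i + 3) x))"

definition Sp ::
  "('f::field \<Rightarrow> 'v::ab_group_add \<Rightarrow> 'v) \<Rightarrow> ('v \<Rightarrow> 'v \<Rightarrow> 'f) \<Rightarrow> ('v \<Rightarrow> 'v) set"
  where "Sp scale \<Omega> = {A. Vector_Spaces.linear scale scale A \<and> bij A \<and>
    (\<forall>x y. \<Omega> (A x) (A y) = \<Omega> x y)}"

definition act :: "('v \<Rightarrow> 'v) \<Rightarrow> ('v \<Rightarrow> 'v \<Rightarrow> 'v \<Rightarrow> 'f) \<Rightarrow> 'v \<Rightarrow> 'v \<Rightarrow> 'v \<Rightarrow> 'f"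
  where "act A \<theta> x y z = \<theta> (inv_into UNIV A x) (inv_into UNIV A y) (inv_into UNIV A z)"


section \<open>Polynomial functions on the space of 3-forms\<close>

text \<open>
  Functions on a set \<open>X\<close> are represented by extensional functions (arbitrary but fixed
  outside \<open>X\<close>), so that equality means equality on \<open>X\<close>. The following is the
  unital subalgebra generated by the restrictions to \<open>X\<close> of the functions in \<open>G\<close>.
\<close>

inductive_set generated_algebra :: "'x set \<Rightarrow> ('x \<Rightarrow> 'f::comm_ring_1) set \<Rightarrow> ('x \<Rightarrow> 'f) set"
  for X :: "'x set" and G :: "('x \<Rightarrow> 'f) set"
  where
    const: "(\<lambda>x\<in>X. c) \<in> generated_algebra X G"
  | gen: "g \<in> G \<Longrightarrow> restrict g X \<in> generated_algebra X G"
  | add: "f \<in> generated_algebra X G \<Longrightarrow> g \<in> generated_algebra X G \<Longrightarrow>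
      (\<lambda>x\<in>X. f x + g x) \<in> generated_algebra X G"
  | mult: "f \<in> generated_algebra X G \<Longrightarrow> g \<in> generated_algebra X G \<Longrightarrow>
      (\<lambda>x\<in>X. f x * g x) \<in> generated_algebra X G"

definition linear_functionals ::
  "('f::field \<Rightarrow> 'v::ab_group_add \<Rightarrow> 'v) \<Rightarrow> (('v \<Rightarrow> 'v \<Rightarrow> 'v \<Rightarrow> 'f) \<Rightarrow> 'f) set"
  where "linear_functionals scale = {\<phi>.
    (\<forall>\<theta>\<in>three_forms scale. \<forall>\<eta>\<in>three_forms scale.
      \<phi> (\<lambda>x y z. \<theta> x y z + \<eta> x y z) = \<phi> \<theta> + \<phi> \<eta>) \<and>
    (\<forall>c. \<forall>\<theta>\<in>three_forms scale. \<phi> (\<lambda>x y z. c * \<theta> x y z) = c * \<phi> \<theta>)}"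

definition polynomial_functions ::
  "('f::field \<Rightarrow> 'v::ab_group_add \<Rightarrow> 'v) \<Rightarrow> (('v \<Rightarrow> 'v \<Rightarrow> 'v \<Rightarrow> 'f) \<Rightarrow> 'f) set"
  where "polynomial_functions scale =
    generated_algebra (three_forms scale) (linear_functionals scale)"

definition invariant_polynomials ::
  "('f::field \<Rightarrow> 'v::ab_group_add \<Rightarrow> 'v) \<Rightarrow> ('v \<Rightarrow> 'v \<Rightarrow> 'f) \<Rightarrow> (('v \<Rightarrow> 'v \<Rightarrow> 'v \<Rightarrow> 'f) \<Rightarrow> 'f) set"
  where "invariant_polynomials scale \<Omega> = {I \<in> polynomial_functions scale.
    \<forall>\<theta>\<in>three_forms scale. \<forall>A\<in>Sp scale \<Omega>. I (act A \<theta>) = I \<theta>}"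


section \<open>The invariants\<close>

definition Jmap ::
  "('f::field \<Rightarrow> 'v::ab_group_add \<Rightarrow> 'v) \<Rightarrow> ('v \<Rightarrow> 'v \<Rightarrow> 'f) \<Rightarrow> ('v \<Rightarrow> 'v \<Rightarrow> 'v \<Rightarrow> 'f) \<Rightarrow> 'v \<Rightarrow> 'v \<Rightarrow> 'v"
  where "Jmap scale \<Omega> \<theta> = (THE J. alternating_bilinear scale scale J \<and>
    (\<forall>x y z. \<theta> x y z = \<Omega> (J x y) z))"

definition vtheta :: "('v \<Rightarrow> 'v \<Rightarrow> 'f::field_char_0) \<Rightarrow> ('v \<Rightarrow> 'v \<Rightarrow> 'v \<Rightarrow> 'f) \<Rightarrow> 'v"
  where "vtheta \<Omega> \<theta> = (THE u.
    insertion u (wedge 4 2 (wedge 2 2 (form2 \<Omega>) (form2 \<Omega>)) (form2 \<Omega>)) =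
    wedge 3 2 (form3 \<theta>) (form2 \<Omega>))"

definition Lmap ::
  "('f::field_char_0 \<Rightarrow> 'v::ab_group_add \<Rightarrow> 'v) \<Rightarrow> ('v \<Rightarrow> 'v \<Rightarrow> 'f) \<Rightarrow> ('v \<Rightarrow> 'v \<Rightarrow> 'v \<Rightarrow> 'f) \<Rightarrow> 'v \<Rightarrow> 'v"
  where "Lmap scale \<Omega> \<theta> y = Jmap scale \<Omega> \<theta> (vtheta \<Omega> \<theta>) y"

text \<open>Matrix indices start at 0, hence the shift.\<close>

definition endo_matrix ::
  "('f::field \<Rightarrow> 'v::ab_group_add \<Rightarrow> 'v) \<Rightarrow> (nat \<Rightarrow> 'v) \<Rightarrow> ('v \<Rightarrow> 'v) \<Rightarrow> 'f mat"
  where "endo_matrix scale v L =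
    mat 6 6 (\<lambda>(i, j). dual_basis scale v (Suc i) (L (v (Suc j))))"

definition I1 ::
  "('f::field_char_0 \<Rightarrow> 'v::ab_group_add \<Rightarrow> 'v) \<Rightarrow> ('v \<Rightarrow> 'v \<Rightarrow> 'f) \<Rightarrow> (nat \<Rightarrow> 'v) \<Rightarrow>
    ('v \<Rightarrow> 'v \<Rightarrow> 'v \<Rightarrow> 'f) \<Rightarrow> 'f"
  where "I1 scale \<Omega> v \<theta> =
    - 18 * coeff (char_poly (endo_matrix scale v (Lmap scale \<Omega> \<theta>))) 4"

definition barwedge :: "('v \<Rightarrow> 'v \<Rightarrow> 'v::ab_group_add) \<Rightarrow> 'v \<Rightarrow> 'v \<Rightarrow> 'v \<Rightarrow> 'v"
  where "barwedge J x y z = J (J x y) z + J (J y z) x + J (J z x) y"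

definition xi ::
  "('f::field \<Rightarrow> 'v::ab_group_add \<Rightarrow> 'v) \<Rightarrow> ('v \<Rightarrow> 'v \<Rightarrow> 'f) \<Rightarrow> (nat \<Rightarrow> 'v) \<Rightarrow>
    ('v \<Rightarrow> 'v \<Rightarrow> 'v \<Rightarrow> 'f) \<Rightarrow> nat \<Rightarrow> nat \<Rightarrow> nat \<Rightarrow> nat \<Rightarrow> 'f"
  where "xi scale \<Omega> v \<theta> i j k l =
    dual_basis scale v l (barwedge (Jmap scale \<Omega> \<theta>) (v i) (v j) (v k))"

definition I2 ::
  "('f::field_char_0 \<Rightarrow> 'v::ab_group_add \<Rightarrow> 'v) \<Rightarrow> ('v \<Rightarrow> 'v \<Rightarrow> 'f) \<Rightarrow> (nat \<Rightarrow> 'v) \<Rightarrow>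
    ('v \<Rightarrow> 'v \<Rightarrow> 'v \<Rightarrow> 'f) \<Rightarrow> 'f"
  where "I2 scale \<Omega> v \<theta> = - (1 / 3) * (\<Sum>l = 1..3. \<Sum>\<sigma> | \<sigma> permutes {1..6}.
    of_int (sign \<sigma>) * xi scale \<Omega> v \<theta> (\<sigma> 1) (\<sigma> 2) (\<sigma> 3) l
                    * xi scale \<Omega> v \<theta> (\<sigma> 4) (\<sigma> 5) (\<sigma> 6) (l + 3))"

end

theory Submission
  imports Defs
begin

text \<open>
  Restrict everything to the affine plane of forms
  \<open>v\<^sup>1\<^sup>2\<^sup>6 + v\<^sup>1\<^sup>4\<^sup>5 + v\<^sup>2\<^sup>3\<^sup>5 + v\<^sup>3\<^sup>5\<^sup>6 + s v\<^sup>2\<^sup>3\<^sup>4 + t v\<^sup>4\<^sup>5\<^sup>6\<close>, on which \<open>I\<^sub>1 = t\<close> and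
  \<open>I\<^sub>2 = 120 t - 288 s\<close>. Every polynomial function agrees on this plane with a polynomial in
  \<open>I\<^sub>1\<close> and \<open>I\<^sub>2\<close>, so it suffices that an invariant polynomial \<open>D\<close> which vanishes on the plane is zero.
  A transvection \<open>x \<mapsto> x + r \<Omega>(u, x) u\<close> moves \<open>\<theta>\<close> along a straight line, because \<open>\<theta>\<close> kills
  repeated arguments. At each point of the plane, the directions of these lines together with the plane
  itself span the space of 3-forms. Hence the set of polynomials vanishing on all translates of the
  plane is closed under directional derivatives, all derivatives of \<open>D\<close> vanish at a point, and
  \<open>D = 0\<close> in characteristic zero.

  For the invariance of \<open>I\<^sub>2\<close>, an alternating 6-form is a multiple of the form
  \<open>\<Omega> \<and> \<Omega> \<and> \<Omega>\<close>, which is invariant under the symplectic group.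
\<close>

section \<open>Coordinates\<close>

text \<open>The plane is a slice of Kostant type. The torus element scaling the six dual basis
  covectors by the powers 3, -1, 1, -3, 1, -1 of a nonzero scalar c is symplectic. It multiplies the
  four fixed monomials by c and the two monomials carrying s and t by c^(-3). After division by c it
  maps the plane to itself and scales both s and t by c^(-4). An invariant of degree 4 therefore
  restricts to a linear form in s and t, and two invariants with independent linear forms recover
  both coordinates. Since 288 is invertible, \<open>I1\<close> and \<open>I2\<close> do so.

  Transversality is required at every point of the plane and not only at a generic one: a derivative
  can be differentiated again within the argument only if it vanishes on the whole plane and on all
  of its translates. This formal argument takes the place of showing that the translates of the
  plane are dense.\<close>

definition lin :: "('f::field \<Rightarrow> 'v::ab_group_add \<Rightarrow> 'v) \<Rightarrow> ('v \<Rightarrow> 'f) \<Rightarrow> bool"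
  where "lin scale f \<longleftrightarrow> (\<forall>x y. f (x + y) = f x + f y) \<and> (\<forall>c x. f (scale c x) = c * f x)"

locale symplectic_space = vector_space scale
  for scale :: "'f::field_char_0 \<Rightarrow> 'v::ab_group_add \<Rightarrow> 'v" +
  fixes \<Omega> :: "'v \<Rightarrow> 'v \<Rightarrow> 'f" and v :: "nat \<Rightarrow> 'v"
  assumes sympl: "symplectic_basis scale \<Omega> v"
begin

abbreviation co :: "nat \<Rightarrow> 'v \<Rightarrow> 'f" where "co \<equiv> dual_basis scale v"

abbreviation X :: "('v \<Rightarrow> 'v \<Rightarrow> 'v \<Rightarrow> 'f) set" where "X \<equiv> three_forms scale"

lemma vector_space_mult: "vector_space ((*) :: 'f \<Rightarrow> 'f \<Rightarrow> 'f)"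
  by unfold_locales (auto simp: algebra_simps)

lemma linear_iff_lin: "Vector_Spaces.linear scale (*) f \<longleftrightarrow> lin scale f"
  by (auto simp: Vector_Spaces.linear_iff lin_def vector_space_mult vector_space_axioms)

lemma linear_iff_add_scale:
  "Vector_Spaces.linear scale scale f \<longleftrightarrow>
    (\<forall>x y. f (x + y) = f x + f y) \<and> (\<forall>c x. f (scale c x) = scale c (f x))"
  by (auto simp: Vector_Spaces.linear_iff vector_space_axioms)

lemma basis: "inj_on v {1..6}" "independent (v ` {1..6})" "span (v ` {1..6}) = UNIV"
  and Omega_co: "\<Omega> x y = (\<Sum>i = 1..3. co i x * co (i + 3) y - co i y * co (i + 3) x)"
  using sympl by (auto simp: symplectic_basis_def)

lemma co_add [simp]: "co i (x + y) = co i x + co i y"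
  and co_scale [simp]: "co i (scale c x) = c * co i x"
  using basis by (auto simp: dual_basis_def representation_add representation_scale)

lemma co_0 [simp]: "co i 0 = 0"
  using co_scale[of i 0 0] by simp

lemma co_minus [simp]: "co i (- x) = - co i x"
  using co_scale[of i "-1" x] by simp

lemma co_diff [simp]: "co i (x - y) = co i x - co i y"
  using co_add[of i x "- y"] by simp

lemma co_basis: "i \<in> {1..6} \<Longrightarrow> j \<in> {1..6} \<Longrightarrow> co i (v j) = (if i = j then 1 else 0)"
  using basis by (auto simp: dual_basis_def representation_basis dest: inj_onD)

lemma co_expand: "(\<Sum>i = 1..6. scale (co i x) (v i)) = x"
proof -
  have "(\<Sum>b\<in>v ` {1..6}. scale (representation (v ` {1..6}) x b) b) = x"
    by (rule sum_representation_eq) (use basis in auto)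
  then show ?thesis
    by (subst (asm) sum.reindex) (use basis in \<open>auto simp: dual_basis_def\<close>)
qed

lemma co_eqI: "(\<And>i. i \<in> {1..6} \<Longrightarrow> co i x = co i y) \<Longrightarrow> x = y"
  by (metis (no_types, lifting) co_expand sum.cong)

lemma lin_sum: "lin scale f \<Longrightarrow> f (sum g S) = (\<Sum>s\<in>S. f (g s))"
proof (induction S rule: infinite_finite_induct)
  case (infinite A)
  then show ?case by (metis lin_def add_cancel_right_left sum.infinite)
next
  case empty
  then show ?case by (metis lin_def add_cancel_right_left sum.empty)
qed (auto simp: lin_def)

lemma lin_expand: "lin scale f \<Longrightarrow> f x = (\<Sum>i = 1..6. co i x * f (v i))"
  by (subst co_expand[of x, symmetric], subst lin_sum) (auto simp: lin_def)

lemma Icc16: "{1..6::nat} = {1, 2, 3, 4, 5, 6}" and Icc13: "{1..3::nat} = {1, 2, 3}"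
  by auto

lemma Omega_explicit:
  "\<Omega> x y = co 1 x * co 4 y - co 1 y * co 4 x + (co 2 x * co 5 y - co 2 y * co 5 x)
    + (co 3 x * co 6 y - co 3 y * co 6 x)"
  by (simp add: Omega_co Icc13 del: One_nat_def)

lemma Omega_alt [simp]: "\<Omega> x x = 0" and Omega_swap: "\<Omega> y x = - \<Omega> x y"
  by (simp_all add: Omega_explicit algebra_simps)

lemma Omega_add_left [simp]: "\<Omega> (x + x') y = \<Omega> x y + \<Omega> x' y"
  and Omega_add_right [simp]: "\<Omega> x (y + y') = \<Omega> x y + \<Omega> x y'"
  and Omega_scale_left [simp]: "\<Omega> (scale c x) y = c * \<Omega> x y"
  and Omega_scale_right [simp]: "\<Omega> x (scale c y) = c * \<Omega> x y"
  by (simp_all add: Omega_explicit algebra_simps)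

lemma co_basis_simps [simp]:
  "co (Suc 0) (v (Suc 0)) = 1" "co (Suc 0) (v 2) = 0" "co (Suc 0) (v 3) = 0" "co (Suc 0) (v 4) = 0"
  "co (Suc 0) (v 5) = 0" "co (Suc 0) (v 6) = 0"
  "co 2 (v (Suc 0)) = 0" "co 2 (v 2) = 1" "co 2 (v 3) = 0" "co 2 (v 4) = 0" "co 2 (v 5) = 0" "co 2 (v 6) = 0"
  "co 3 (v (Suc 0)) = 0" "co 3 (v 2) = 0" "co 3 (v 3) = 1" "co 3 (v 4) = 0" "co 3 (v 5) = 0" "co 3 (v 6) = 0"
  "co 4 (v (Suc 0)) = 0" "co 4 (v 2) = 0" "co 4 (v 3) = 0" "co 4 (v 4) = 1" "co 4 (v 5) = 0" "co 4 (v 6) = 0"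
  "co 5 (v (Suc 0)) = 0" "co 5 (v 2) = 0" "co 5 (v 3) = 0" "co 5 (v 4) = 0" "co 5 (v 5) = 1" "co 5 (v 6) = 0"
  "co 6 (v (Suc 0)) = 0" "co 6 (v 2) = 0" "co 6 (v 3) = 0" "co 6 (v 4) = 0" "co 6 (v 5) = 0" "co 6 (v 6) = 1"
  by (simp_all add: co_basis)

lemma Omega_basis_left:
  "\<Omega> (v 1) y = co 4 y" "\<Omega> (v 2) y = co 5 y" "\<Omega> (v 3) y = co 6 y"
  "\<Omega> (v 4) y = - co 1 y" "\<Omega> (v 5) y = - co 2 y" "\<Omega> (v 6) y = - co 3 y"
  by (simp_all add: Omega_explicit)

lemma Omega_basis_right:
  "\<Omega> y (v 1) = - co 4 y" "\<Omega> y (v 2) = - co 5 y" "\<Omega> y (v 3) = - co 6 y"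
  "\<Omega> y (v 4) = co 1 y" "\<Omega> y (v 5) = co 2 y" "\<Omega> y (v 6) = co 3 y"
  by (simp_all add: Omega_explicit)

lemma Omega_nondegenerate: "(\<And>z. \<Omega> x z = \<Omega> y z) \<Longrightarrow> x = y"
  by (rule co_eqI) (metis Icc16 Omega_basis_right add.inverse_inverse empty_iff insert_iff)

lemma three_forms_iff:
  "\<theta> \<in> X \<longleftrightarrow> (\<forall>y z. lin scale (\<lambda>x. \<theta> x y z)) \<and> (\<forall>x z. lin scale (\<lambda>y. \<theta> x y z)) \<and>
    (\<forall>x y. lin scale (\<lambda>z. \<theta> x y z)) \<and> (\<forall>x y. \<theta> x x y = 0 \<and> \<theta> x y y = 0 \<and> \<theta> x y x = 0)"
  by (auto simp: three_forms_def linear_iff_lin)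

section \<open>Three-forms in coordinates\<close>

context
  fixes \<theta> assumes \<theta>: "\<theta> \<in> X"
begin

lemma form_lin: "lin scale (\<lambda>x. \<theta> x y z)" "lin scale (\<lambda>y. \<theta> x y z)" "lin scale (\<lambda>z. \<theta> x y z)"
  using \<theta> by (auto simp: three_forms_iff)

lemma form_add:
  "\<theta> (x + x') y z = \<theta> x y z + \<theta> x' y z"
  "\<theta> x (y + y') z = \<theta> x y z + \<theta> x y' z"
  "\<theta> x y (z + z') = \<theta> x y z + \<theta> x y z'"
  using form_lin by (auto simp: lin_def)

lemma form_scale:
  "\<theta> (scale c x) y z = c * \<theta> x y z"
  "\<theta> x (scale c y) z = c * \<theta> x y z"
  "\<theta> x y (scale c z) = c * \<theta> x y z"
  using form_lin by (auto simp: lin_def)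

lemma form_zero: "\<theta> x x y = 0" "\<theta> x y y = 0" "\<theta> x y x = 0"
  using \<theta> by (auto simp: three_forms_iff)

lemma form_swap12: "\<theta> y x z = - \<theta> x y z"
proof -
  have "\<theta> y x z + \<theta> x y z = \<theta> (x + y) (x + y) z"
    unfolding form_add by (simp add: form_zero)
  also have "\<dots> = 0" by (rule form_zero)
  finally have "\<theta> y x z + \<theta> x y z = 0" .
  then show ?thesis by (simp only: eq_neg_iff_add_eq_0)
qed

lemma form_swap23: "\<theta> x z y = - \<theta> x y z"
proof -
  have "\<theta> x z y + \<theta> x y z = \<theta> x (y + z) (y + z)"
    unfolding form_add by (simp add: form_zero)
  also have "\<dots> = 0" by (rule form_zero)
  finally have "\<theta> x z y + \<theta> x y z = 0" .
  then show ?thesis by (simp only: eq_neg_iff_add_eq_0)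
qed

lemma form_swap13: "\<theta> z y x = - \<theta> x y z"
  using form_swap12 form_swap23 by metis

lemma form_expand:
  "\<theta> x y z = (\<Sum>i = 1..6. \<Sum>j = 1..6. \<Sum>k = 1..6. co i x * co j y * co k z * \<theta> (v i) (v j) (v k))"
proof -
  have "\<theta> x y z = (\<Sum>i = 1..6. co i x * \<theta> (v i) y z)"
    by (rule lin_expand[OF form_lin(1)])
  also have "\<dots> = (\<Sum>i = 1..6. co i x * (\<Sum>j = 1..6. co j y * \<theta> (v i) (v j) z))"
    by (intro sum.cong refl arg_cong2[where f = "(*)"] lin_expand[OF form_lin(2)])
  also have "\<dots> = (\<Sum>i = 1..6. co i x * (\<Sum>j = 1..6. co j y * (\<Sum>k = 1..6. co k z * \<theta> (v i) (v j) (v k))))"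
    by (intro sum.cong refl arg_cong2[where f = "(*)"] lin_expand[OF form_lin(3)])
  finally show ?thesis
    by (simp add: sum_distrib_left mult_ac)
qed

end

text \<open>Listed explicitly so that \<open>simp\<close> can unfold sums and bounded quantifiers
  over the 20 coordinates of a 3-form.\<close>

definition tri :: "(nat \<times> nat \<times> nat) set"
  where "tri = {(1,2,3), (1,2,4), (1,2,5), (1,2,6), (1,3,4), (1,3,5), (1,3,6), (1,4,5), (1,4,6), (1,5,6),
    (2,3,4), (2,3,5), (2,3,6), (2,4,5), (2,4,6), (2,5,6), (3,4,5), (3,4,6), (3,5,6), (4,5,6)}"

lemma tri_iff: "(i, j, k) \<in> tri \<longleftrightarrow> 1 \<le> i \<and> i < j \<and> j < k \<and> k \<le> 6"
proof
  assume a: "1 \<le> i \<and> i < j \<and> j < k \<and> k \<le> 6"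
  then have "i \<in> {1..6}" "j \<in> {1..6}" "k \<in> {1..6}" by auto
  with a show "(i, j, k) \<in> tri"
    unfolding Icc16 by (elim insertE emptyE) (simp_all add: tri_def)
qed (auto simp: tri_def)

text \<open>The exterior product of three dual basis covectors, as a 3 by 3 determinant expanded
  along the argument \<open>x\<close>.\<close>

definition mono :: "nat \<Rightarrow> nat \<Rightarrow> nat \<Rightarrow> 'v \<Rightarrow> 'v \<Rightarrow> 'v \<Rightarrow> 'f"
  where "mono i j k x y z =
    co i x * (co j y * co k z - co k y * co j z) +
    co j x * (co k y * co i z - co i y * co k z) +
    co k x * (co i y * co j z - co j y * co i z)"

lemma mono_form: "mono i j k \<in> X"
  unfolding three_forms_iff lin_def mono_def by (simp add: algebra_simps)

text \<open>An index triple has a repetition or is sorted by swaps. \<open>pair\<close> places the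
  third index relative to an increasing pair; the last case distinction orders the first
  two.\<close>

lemma form_eq_0I:
  assumes \<theta>: "\<theta> \<in> X" and z: "\<And>i j k. (i, j, k) \<in> tri \<Longrightarrow> \<theta> (v i) (v j) (v k) = 0"
  shows "\<theta> x y z = 0"
proof -
  note sw = form_swap12[OF \<theta>] form_swap23[OF \<theta>] form_zero[OF \<theta>]
  have inc: "\<theta> (v i) (v j) (v k) = 0" if "i \<in> {1..6}" "k \<in> {1..6}" "i < j" "j < k" for i j k
    using that z by (auto simp: tri_iff)
  have pair: "\<theta> (v i) (v j) (v k) = 0" if "i \<in> {1..6}" "j \<in> {1..6}" "k \<in> {1..6}" "i < j" for i j k
    using that inc[of i k j] inc[of k j i] inc[of i j k] sw
    by (metis neg_equal_0_iff_equal nat_neq_iff)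
  have "\<theta> (v i) (v j) (v k) = 0" if "i \<in> {1..6}" "j \<in> {1..6}" "k \<in> {1..6}" for i j k
    using that pair[of i j k] pair[of j i k] sw by (metis neg_equal_0_iff_equal nat_neq_iff)
  then show ?thesis
    by (subst form_expand[OF \<theta>]) simp
qed


section \<open>Derivatives of polynomial functions\<close>

definition shift :: "('v \<Rightarrow> 'v \<Rightarrow> 'v \<Rightarrow> 'f) \<Rightarrow> ('v \<Rightarrow> 'v \<Rightarrow> 'v \<Rightarrow> 'f) \<Rightarrow> 'f \<Rightarrow> 'v \<Rightarrow> 'v \<Rightarrow> 'v \<Rightarrow> 'f"
  where "shift \<theta> \<eta> r = (\<lambda>x y z. \<theta> x y z + r * \<eta> x y z)"

lemma form_plus: "\<theta> \<in> X \<Longrightarrow> \<eta> \<in> X \<Longrightarrow> (\<lambda>x y z. \<theta> x y z + \<eta> x y z) \<in> X"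
  and form_times: "\<theta> \<in> X \<Longrightarrow> (\<lambda>x y z. r * \<theta> x y z) \<in> X"
  by (auto simp: three_forms_iff lin_def algebra_simps)

lemma shift_form: "\<theta> \<in> X \<Longrightarrow> \<eta> \<in> X \<Longrightarrow> shift \<theta> \<eta> r \<in> X"
  unfolding shift_def by (intro form_plus form_times)

lemma form_null: "(\<lambda>x y z. 0) \<in> X"
  by (auto simp: three_forms_iff lin_def)

lemma form_sum: "(\<And>i. i \<in> S \<Longrightarrow> \<theta> i \<in> X) \<Longrightarrow> (\<lambda>x y z. \<Sum>i\<in>S. \<theta> i x y z) \<in> X"
  by (induction S rule: infinite_finite_induct) (auto intro: form_plus form_null)

lemma poly_add: "F \<in> polynomial_functions scale \<Longrightarrow> G \<in> polynomial_functions scale \<Longrightarrow>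
    (\<lambda>\<theta>\<in>X. F \<theta> + G \<theta>) \<in> polynomial_functions scale"
  and poly_mult: "F \<in> polynomial_functions scale \<Longrightarrow> G \<in> polynomial_functions scale \<Longrightarrow>
    (\<lambda>\<theta>\<in>X. F \<theta> * G \<theta>) \<in> polynomial_functions scale"
  and poly_const: "(\<lambda>\<theta>\<in>X. c) \<in> polynomial_functions scale"
  unfolding polynomial_functions_def by (auto intro: generated_algebra.intros)

text \<open>A directional derivative without limits and without a polynomial ring in 20 variables:
  on every line \<open>F\<close> is a univariate polynomial, and its \<open>pderiv\<close> gives
  \<open>dF\<close> along the same line. Linearity in the direction allows a test on spanning
  directions, and polynomiality of \<open>dF \<eta>\<close> allows differentiating again.\<close>

definition derivation_of ::
  "(('v \<Rightarrow> 'v \<Rightarrow> 'v \<Rightarrow> 'f) \<Rightarrow> 'f) \<Rightarrow> (('v \<Rightarrow> 'v \<Rightarrow> 'v \<Rightarrow> 'f) \<Rightarrow> ('v \<Rightarrow> 'v \<Rightarrow> 'v \<Rightarrow> 'f) \<Rightarrow> 'f) \<Rightarrow> bool"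
  where "derivation_of F dF \<longleftrightarrow>
    (\<forall>\<eta>\<in>X. dF \<eta> \<in> polynomial_functions scale) \<and>
    (\<forall>\<theta>\<in>X. \<forall>\<eta>\<in>X. \<forall>\<zeta>\<in>X. dF (\<lambda>x y z. \<eta> x y z + \<zeta> x y z) \<theta> = dF \<eta> \<theta> + dF \<zeta> \<theta>) \<and>
    (\<forall>\<theta>\<in>X. \<forall>\<eta>\<in>X. \<forall>c. dF (\<lambda>x y z. c * \<eta> x y z) \<theta> = c * dF \<eta> \<theta>) \<and>
    (\<forall>\<theta>\<in>X. \<forall>\<eta>\<in>X. \<exists>g. \<forall>r. poly g r = F (shift \<theta> \<eta> r) \<and> poly (pderiv g) r = dF \<eta> (shift \<theta> \<eta> r))"

lemma derivation_ofI:
  assumes "\<And>\<eta>. \<eta> \<in> X \<Longrightarrow> dF \<eta> \<in> polynomial_functions scale"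
    and "\<And>\<theta> \<eta> \<zeta>. \<theta> \<in> X \<Longrightarrow> \<eta> \<in> X \<Longrightarrow> \<zeta> \<in> X \<Longrightarrow>
      dF (\<lambda>x y z. \<eta> x y z + \<zeta> x y z) \<theta> = dF \<eta> \<theta> + dF \<zeta> \<theta>"
    and "\<And>\<theta> \<eta> c. \<theta> \<in> X \<Longrightarrow> \<eta> \<in> X \<Longrightarrow> dF (\<lambda>x y z. c * \<eta> x y z) \<theta> = c * dF \<eta> \<theta>"
    and "\<And>\<theta> \<eta>. \<theta> \<in> X \<Longrightarrow> \<eta> \<in> X \<Longrightarrow>
      \<exists>g. \<forall>r. poly g r = F (shift \<theta> \<eta> r) \<and> poly (pderiv g) r = dF \<eta> (shift \<theta> \<eta> r)"
  shows "derivation_of F dF"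
  using assms unfolding derivation_of_def by blast

lemma derivation_ofD:
  assumes "derivation_of F dF"
  shows "\<And>\<eta>. \<eta> \<in> X \<Longrightarrow> dF \<eta> \<in> polynomial_functions scale"
    and "\<And>\<theta> \<eta> \<zeta>. \<theta> \<in> X \<Longrightarrow> \<eta> \<in> X \<Longrightarrow> \<zeta> \<in> X \<Longrightarrow>
      dF (\<lambda>x y z. \<eta> x y z + \<zeta> x y z) \<theta> = dF \<eta> \<theta> + dF \<zeta> \<theta>"
    and "\<And>\<theta> \<eta> c. \<theta> \<in> X \<Longrightarrow> \<eta> \<in> X \<Longrightarrow> dF (\<lambda>x y z. c * \<eta> x y z) \<theta> = c * dF \<eta> \<theta>"
    and "\<And>\<theta> \<eta>. \<theta> \<in> X \<Longrightarrow> \<eta> \<in> X \<Longrightarrow>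
      \<exists>g. \<forall>r. poly g r = F (shift \<theta> \<eta> r) \<and> poly (pderiv g) r = dF \<eta> (shift \<theta> \<eta> r)"
  using assms unfolding derivation_of_def by blast+

lemma derivation_const: "derivation_of (\<lambda>\<theta>\<in>X. c) (\<lambda>\<eta>. \<lambda>\<theta>\<in>X. 0)"
proof (rule derivation_ofI)
  show "\<exists>g. \<forall>r. poly g r = (\<lambda>\<theta>\<in>X. c) (shift \<theta> \<eta> r) \<and>
      poly (pderiv g) r = (\<lambda>\<theta>\<in>X. 0) (shift \<theta> \<eta> r)" if "\<theta> \<in> X" "\<eta> \<in> X" for \<theta> \<eta>
    using that by (intro exI[of _ "[:c:]"]) (auto simp: shift_form)
qed (auto simp: poly_const)

lemma linear_functional_shift:
  assumes "\<phi> \<in> linear_functionals scale" "\<theta> \<in> X" "\<eta> \<in> X"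
  shows "\<phi> (shift \<theta> \<eta> r) = \<phi> \<theta> + r * \<phi> \<eta>"
  using assms form_times[of \<eta> r] by (auto simp: linear_functionals_def shift_def)

lemma derivation_linear:
  assumes "\<phi> \<in> linear_functionals scale"
  shows "derivation_of (restrict \<phi> X) (\<lambda>\<eta>. \<lambda>\<theta>\<in>X. \<phi> \<eta>)"
proof (rule derivation_ofI)
  fix \<theta> \<eta> assume "\<theta> \<in> X" "\<eta> \<in> X"
  moreover from this have "\<phi> (shift \<theta> \<eta> r) = \<phi> \<theta> + r * \<phi> \<eta>" for r
    by (rule linear_functional_shift[OF assms])
  ultimately show "\<exists>g. \<forall>r. poly g r = restrict \<phi> X (shift \<theta> \<eta> r) \<and>
      poly (pderiv g) r = (\<lambda>\<theta>\<in>X. \<phi> \<eta>) (shift \<theta> \<eta> r)"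
    by (intro exI[of _ "[:\<phi> \<theta>, \<phi> \<eta>:]"]) (auto simp: shift_form pderiv_pCons)
qed (use assms in \<open>auto simp: poly_const linear_functionals_def\<close>)

lemma derivation_add:
  assumes F: "derivation_of F dF" and G: "derivation_of G dG"
  shows "derivation_of (\<lambda>\<theta>\<in>X. F \<theta> + G \<theta>) (\<lambda>\<eta>. \<lambda>\<theta>\<in>X. dF \<eta> \<theta> + dG \<eta> \<theta>)"
proof (rule derivation_ofI)
  fix \<theta> \<eta> assume *: "\<theta> \<in> X" "\<eta> \<in> X"
  obtain g h where "\<forall>r. poly g r = F (shift \<theta> \<eta> r) \<and> poly (pderiv g) r = dF \<eta> (shift \<theta> \<eta> r)"
    "\<forall>r. poly h r = G (shift \<theta> \<eta> r) \<and> poly (pderiv h) r = dG \<eta> (shift \<theta> \<eta> r)"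
    using derivation_ofD(4)[OF F *] derivation_ofD(4)[OF G *] by blast
  with * show "\<exists>g. \<forall>r. poly g r = (\<lambda>\<theta>\<in>X. F \<theta> + G \<theta>) (shift \<theta> \<eta> r) \<and>
      poly (pderiv g) r = (\<lambda>\<theta>\<in>X. dF \<eta> \<theta> + dG \<eta> \<theta>) (shift \<theta> \<eta> r)"
    by (intro exI[of _ "g + h"]) (auto simp: shift_form pderiv_add)
qed (use derivation_ofD[OF F] derivation_ofD[OF G] in \<open>simp_all add: poly_add algebra_simps\<close>)

lemma derivation_mult:
  assumes F: "derivation_of F dF" and G: "derivation_of G dG"
    and FG: "F \<in> polynomial_functions scale" "G \<in> polynomial_functions scale"
  shows "derivation_of (\<lambda>\<theta>\<in>X. F \<theta> * G \<theta>) (\<lambda>\<eta>. \<lambda>\<theta>\<in>X. dF \<eta> \<theta> * G \<theta> + F \<theta> * dG \<eta> \<theta>)"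
proof (rule derivation_ofI)
  fix \<theta> \<eta> assume *: "\<theta> \<in> X" "\<eta> \<in> X"
  obtain g h where "\<forall>r. poly g r = F (shift \<theta> \<eta> r) \<and> poly (pderiv g) r = dF \<eta> (shift \<theta> \<eta> r)"
    "\<forall>r. poly h r = G (shift \<theta> \<eta> r) \<and> poly (pderiv h) r = dG \<eta> (shift \<theta> \<eta> r)"
    using derivation_ofD(4)[OF F *] derivation_ofD(4)[OF G *] by blast
  with * show "\<exists>g. \<forall>r. poly g r = (\<lambda>\<theta>\<in>X. F \<theta> * G \<theta>) (shift \<theta> \<eta> r) \<and>
      poly (pderiv g) r = (\<lambda>\<theta>\<in>X. dF \<eta> \<theta> * G \<theta> + F \<theta> * dG \<eta> \<theta>) (shift \<theta> \<eta> r)"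
    by (intro exI[of _ "g * h"]) (auto simp: shift_form pderiv_mult)
next
  fix \<eta> assume "\<eta> \<in> X"
  then have "(\<lambda>\<theta>\<in>X. (\<lambda>\<theta>\<in>X. dF \<eta> \<theta> * G \<theta>) \<theta> + (\<lambda>\<theta>\<in>X. F \<theta> * dG \<eta> \<theta>) \<theta>) \<in> polynomial_functions scale"
    using derivation_ofD(1)[OF F] derivation_ofD(1)[OF G] FG by (intro poly_add poly_mult) auto
  then show "(\<lambda>\<theta>\<in>X. dF \<eta> \<theta> * G \<theta> + F \<theta> * dG \<eta> \<theta>) \<in> polynomial_functions scale"
    by (simp cong: restrict_cong)
qed (use derivation_ofD(2,3)[OF F] derivation_ofD(2,3)[OF G] in \<open>simp_all add: algebra_simps\<close>)

lemma derivation_exists: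
  assumes "F \<in> polynomial_functions scale"
  obtains dF where "derivation_of F dF"
proof -
  have "\<exists>dF. derivation_of F dF"
    using assms unfolding polynomial_functions_def
    by (induction rule: generated_algebra.induct)
      (blast intro: derivation_const derivation_linear derivation_add
        derivation_mult[unfolded polynomial_functions_def])+
  then show ?thesis using that by blast
qed

section \<open>The symplectic group\<close>

lemma SpD:
  assumes "A \<in> Sp scale \<Omega>"
  shows "A (x + y) = A x + A y" "A (scale c x) = scale c (A x)" "bij A" "\<Omega> (A x) (A y) = \<Omega> x y"
    "inv_into UNIV A (A x) = x" "A (inv_into UNIV A x) = x"
  using assms by (auto simp: Sp_def linear_iff_add_scale bij_is_inj bij_is_surj surj_f_inv_f)

lemma SpI:
  assumes "\<And>x y. A (x + y) = A x + A y" "\<And>c x. A (scale c x) = scale c (A x)"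
    "\<And>x y. \<Omega> (A x) (A y) = \<Omega> x y" "\<And>x. A (B x) = x" "\<And>x. B (A x) = x"
  shows "A \<in> Sp scale \<Omega>"
  using assms by (auto simp: Sp_def linear_iff_add_scale intro!: o_bij[of B A])

lemma Sp_inv:
  assumes A: "A \<in> Sp scale \<Omega>"
  shows "inv_into UNIV A \<in> Sp scale \<Omega>"
proof (rule SpI[where B = A])
  note AA = SpD[OF A]
  show "inv_into UNIV A (x + y) = inv_into UNIV A x + inv_into UNIV A y" for x y
    by (metis AA(1,5,6))
  show "inv_into UNIV A (scale c x) = scale c (inv_into UNIV A x)" for c x
    by (metis AA(2,5,6))
  show "\<Omega> (inv_into UNIV A x) (inv_into UNIV A y) = \<Omega> x y" for x y
    by (metis AA(4,6))
qed (use SpD[OF A] in auto)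

lemma Sp_comp: "A \<in> Sp scale \<Omega> \<Longrightarrow> B \<in> Sp scale \<Omega> \<Longrightarrow> A \<circ> B \<in> Sp scale \<Omega>"
  by (rule SpI[where B = "inv_into UNIV B \<circ> inv_into UNIV A"]) (auto simp: SpD)

lemma act_form:
  assumes "A \<in> Sp scale \<Omega>" "\<theta> \<in> X"
  shows "act A \<theta> \<in> X"
  using SpD(1,2)[OF Sp_inv[OF assms(1)]] assms(2)
  by (auto simp: three_forms_iff act_def lin_def)

lemma act_comp: "A \<in> Sp scale \<Omega> \<Longrightarrow> B \<in> Sp scale \<Omega> \<Longrightarrow> act (A \<circ> B) \<theta> = act A (act B \<theta>)"
  by (auto simp: act_def fun_eq_iff o_inv_distrib SpD)

lemma act_shift: "act A (shift \<theta> \<eta> r) = shift (act A \<theta>) (act A \<eta>) r"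
  by (auto simp: act_def shift_def fun_eq_iff)

section \<open>Transvections and the directions they generate\<close>

text \<open>The exponential of the map \<open>\<lambda>x. scale (r * \<Omega> u x) u\<close>, which
  squares to zero because \<open>\<Omega> u u = 0\<close>. Polarized in \<open>u\<close>, these maps
  span the symplectic Lie algebra, so straight lines are enough to probe all tangent directions of
  an orbit.\<close>

definition transvection :: "'v \<Rightarrow> 'f \<Rightarrow> 'v \<Rightarrow> 'v"
  where "transvection u r x = x + scale (r * \<Omega> u x) u"

lemma Omega_diff_right [simp]: "\<Omega> x (y - y') = \<Omega> x y - \<Omega> x y'"
  by (simp add: Omega_explicit algebra_simps)

lemma transvection_inverse: "transvection u r (transvection u (- r) x) = x"
  by (simp add: transvection_def)

lemma transvection_Sp: "transvection u r \<in> Sp scale \<Omega>"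
proof (rule SpI[where B = "transvection u (- r)"])
  show "\<Omega> (transvection u r x) (transvection u r y) = \<Omega> x y" for x y
    using Omega_swap[of x u] by (simp add: transvection_def)
qed (use transvection_inverse[of u "- r"] in
  \<open>simp_all add: transvection_inverse, simp_all add: transvection_def algebra_simps\<close>)

definition orbit_dir :: "'v \<Rightarrow> ('v \<Rightarrow> 'v \<Rightarrow> 'v \<Rightarrow> 'f) \<Rightarrow> 'v \<Rightarrow> 'v \<Rightarrow> 'v \<Rightarrow> 'f"
  where "orbit_dir u \<theta> x y z = \<Omega> u x * \<theta> u y z + \<Omega> u y * \<theta> x u z + \<Omega> u z * \<theta> x y u"

lemma orbit_dir_form:
  assumes \<theta>: "\<theta> \<in> X" shows "orbit_dir u \<theta> \<in> X"
proof -
  have "orbit_dir u \<theta> x x y = 0" "orbit_dir u \<theta> x y y = 0" "orbit_dir u \<theta> x y x = 0" for x y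
    by (simp_all add: orbit_dir_def form_zero[OF \<theta>] form_swap12[OF \<theta>, of u x]
        form_swap23[OF \<theta>, of x u y] form_swap13[OF \<theta>, of x y u])
  then show ?thesis
    unfolding three_forms_iff lin_def
    by (simp add: orbit_dir_def form_add[OF \<theta>] form_scale[OF \<theta>] algebra_simps)
qed

text \<open>The sign in \<open>- r\<close> compensates for the inverse in \<open>act\<close>, so
  that the line is traversed with parameter \<open>r\<close>.\<close>

lemma act_transvection:
  assumes \<theta>: "\<theta> \<in> X"
  shows "act (transvection u (- r)) \<theta> = shift \<theta> (orbit_dir u \<theta>) r"
proof -
  have "inv_into UNIV (transvection u (- r)) = transvection u r"
    using transvection_inverse[of u r] transvection_inverse[of u "- r"]
    by (intro inv_unique_comp) (auto simp: fun_eq_iff)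
  then show ?thesis
    by (auto simp: act_def fun_eq_iff transvection_def shift_def orbit_dir_def
        form_add[OF \<theta>] form_scale[OF \<theta>] form_zero[OF \<theta>] algebra_simps)
qed


section \<open>A section transversal to the orbits\<close>

definition sec :: "'f \<Rightarrow> 'f \<Rightarrow> 'v \<Rightarrow> 'v \<Rightarrow> 'v \<Rightarrow> 'f"
  where "sec s t x y z = mono 1 2 6 x y z + mono 1 4 5 x y z + mono 2 3 5 x y z + mono 3 5 6 x y z
    + s * mono 2 3 4 x y z + t * mono 4 5 6 x y z"

lemma sec_form: "sec s t \<in> X"
  unfolding sec_def by (intro form_plus form_times mono_form)

lemma sec_shift:
  "shift (sec s t) (mono 2 3 4) r = sec (s + r) t" "shift (sec s t) (mono 4 5 6) r = sec s (t + r)"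
  by (auto simp: shift_def sec_def fun_eq_iff algebra_simps)

lemma finite_tri: "finite tri"
  by (simp add: tri_def)

lemma sum_tri:
  "(\<Sum>(i, j, k)\<in>tri. h i j k) =
    h 1 2 3 + h 1 2 4 + h 1 2 5 + h 1 2 6 + h 1 3 4 + h 1 3 5 + h 1 3 6 + h 1 4 5 + h 1 4 6 + h 1 5 6
    + h 2 3 4 + h 2 3 5 + h 2 3 6 + h 2 4 5 + h 2 4 6 + h 2 5 6 + h 3 4 5 + h 3 4 6 + h 3 5 6
    + h 4 5 6" for h :: "nat \<Rightarrow> nat \<Rightarrow> nat \<Rightarrow> 'f"
  by (simp add: tri_def add.assoc)

lemma mono_basis:
  assumes "(i, j, k) \<in> tri" "(a, b, c) \<in> tri"
  shows "mono i j k (v a) (v b) (v c) = (if i = a \<and> j = b \<and> k = c then 1 else 0)"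
proof -
  have "\<forall>(i, j, k)\<in>tri. \<forall>(a, b, c)\<in>tri.
      mono i j k (v a) (v b) (v c) = (if i = a \<and> j = b \<and> k = c then 1 else 0)"
    by (simp add: tri_def mono_def)
  from bspec[OF bspec[OF this assms(1), simplified prod.case] assms(2)] show ?thesis by simp
qed

lemma mono_expand:
  assumes \<theta>: "\<theta> \<in> X"
  shows "\<theta> x y z = (\<Sum>(i, j, k)\<in>tri. \<theta> (v i) (v j) (v k) * mono i j k x y z)"
proof -
  let ?S = "\<lambda>x y z. \<Sum>p\<in>tri. case p of (i, j, k) \<Rightarrow> \<theta> (v i) (v j) (v k) * mono i j k x y z"
  have S: "?S \<in> X"
    by (intro form_sum) (auto intro: form_times mono_form)
  have "?S (v a) (v b) (v c) = \<theta> (v a) (v b) (v c)" if "(a, b, c) \<in> tri" for a b c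
  proof -
    have "?S (v a) (v b) (v c) = (\<Sum>p\<in>tri. if p = (a, b, c) then \<theta> (v a) (v b) (v c) else 0)"
    proof (intro sum.cong refl)
      fix p assume p: "p \<in> tri"
      obtain i j k where "p = (i, j, k)" by (cases p)
      with p that show "(case p of (i, j, k) \<Rightarrow> \<theta> (v i) (v j) (v k) * mono i j k (v a) (v b) (v c))
          = (if p = (a, b, c) then \<theta> (v a) (v b) (v c) else 0)"
        by (simp add: mono_basis)
    qed
    then show ?thesis using that by (simp add: finite_tri)
  qed
  moreover have "(\<lambda>x y z. \<theta> x y z + (- 1) * ?S x y z) \<in> X"
    by (rule form_plus[OF \<theta> form_times[OF S]])
  from form_eq_0I[OF this, of x y z] calculation show ?thesis
    by simp
qed

text \<open>Additivity is available only on 3-forms, so the induction over subsets of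
  \<open>tri\<close> has to use that the partial sums are 3-forms.\<close>

lemma linear_functional_expand:
  assumes add: "\<And>\<eta> \<zeta>. \<eta> \<in> X \<Longrightarrow> \<zeta> \<in> X \<Longrightarrow> \<phi> (\<lambda>x y z. \<eta> x y z + \<zeta> x y z) = \<phi> \<eta> + \<phi> \<zeta>"
    and mult: "\<And>c \<eta>. \<eta> \<in> X \<Longrightarrow> \<phi> (\<lambda>x y z. c * \<eta> x y z) = c * (\<phi> \<eta> :: 'f)"
    and \<theta>: "\<theta> \<in> X"
  shows "\<phi> \<theta> = (\<Sum>(i, j, k)\<in>tri. \<theta> (v i) (v j) (v k) * \<phi> (mono i j k))"
proof -
  have 0: "\<phi> (\<lambda>x y z. 0) = 0"
    using mult[OF form_null, of 0] by simp
  have 1: "\<phi> (\<lambda>x y z. \<Sum>p\<in>S. case p of (i, j, k) \<Rightarrow> \<theta> (v i) (v j) (v k) * mono i j k x y z) =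
      (\<Sum>(i, j, k)\<in>S. \<theta> (v i) (v j) (v k) * \<phi> (mono i j k))" for S
  proof (induction S rule: infinite_finite_induct)
    case (insert p S)
    obtain i j k where p: "p = (i, j, k)" by (cases p)
    have "(\<lambda>x y z. \<Sum>p\<in>S. case p of (i, j, k) \<Rightarrow> \<theta> (v i) (v j) (v k) * mono i j k x y z) \<in> X"
      by (intro form_sum) (auto intro: form_times mono_form)
    with insert show ?case
      using add[OF form_times[OF mono_form]] by (simp add: p mult mono_form)
  qed (auto simp: 0)
  have 2: "\<theta> = (\<lambda>x y z. \<Sum>p\<in>tri. case p of (i, j, k) \<Rightarrow> \<theta> (v i) (v j) (v k) * mono i j k x y z)"
    by (intro ext mono_expand[OF \<theta>])
  show ?thesis
    using arg_cong[OF 2, of \<phi>] 1 by (rule trans)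
qed

text \<open>The polarization of \<open>orbit_dir\<close> in \<open>u\<close>; on the diagonal it is
  twice \<open>orbit_dir u\<close>. Unordered pairs of basis vectors give the 21 directions of the
  symplectic Lie algebra, against 18 unknowns once the two plane directions are removed.\<close>

definition orbit_dir2 :: "'v \<Rightarrow> 'v \<Rightarrow> ('v \<Rightarrow> 'v \<Rightarrow> 'v \<Rightarrow> 'f) \<Rightarrow> 'v \<Rightarrow> 'v \<Rightarrow> 'v \<Rightarrow> 'f"
  where "orbit_dir2 u w \<theta> x y z = \<Omega> u x * \<theta> w y z + \<Omega> u y * \<theta> x w z + \<Omega> u z * \<theta> x y w +
    (\<Omega> w x * \<theta> u y z + \<Omega> w y * \<theta> x u z + \<Omega> w z * \<theta> x y u)"

text \<open>Written with sums and the scalar \<open>- 1\<close> so that additivity and homogeneity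
  of a functional apply literally.\<close>

lemma orbit_dir2_polar:
  assumes "\<theta> \<in> X"
  shows "orbit_dir2 u w \<theta> =
    (\<lambda>x y z. orbit_dir (u + w) \<theta> x y z + - 1 * (orbit_dir u \<theta> x y z + orbit_dir w \<theta> x y z))"
  by (intro ext) (simp add: orbit_dir2_def orbit_dir_def form_add[OF assms] algebra_simps)

lemma orbit_dir2_form: "\<theta> \<in> X \<Longrightarrow> orbit_dir2 u w \<theta> \<in> X"
  unfolding orbit_dir2_polar by (intro form_plus form_times orbit_dir_form)

lemma sec_basis:
  "sec s t (v 1) (v 2) (v 3) = 0" "sec s t (v 1) (v 2) (v 4) = 0"
  "sec s t (v 1) (v 2) (v 5) = 0" "sec s t (v 1) (v 2) (v 6) = 1"
  "sec s t (v 1) (v 3) (v 4) = 0" "sec s t (v 1) (v 3) (v 5) = 0"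
  "sec s t (v 1) (v 3) (v 6) = 0" "sec s t (v 1) (v 4) (v 5) = 1"
  "sec s t (v 1) (v 4) (v 6) = 0" "sec s t (v 1) (v 5) (v 6) = 0"
  "sec s t (v 2) (v 3) (v 4) = s" "sec s t (v 2) (v 3) (v 5) = 1"
  "sec s t (v 2) (v 3) (v 6) = 0" "sec s t (v 2) (v 4) (v 5) = 0"
  "sec s t (v 2) (v 4) (v 6) = 0" "sec s t (v 2) (v 5) (v 6) = 0"
  "sec s t (v 3) (v 4) (v 5) = 0" "sec s t (v 3) (v 4) (v 6) = 0"
  "sec s t (v 3) (v 5) (v 6) = 1" "sec s t (v 4) (v 5) (v 6) = t"
  by (simp_all add: sec_def mono_def)

text \<open>The premises are decided on numerals and orient the antisymmetry: \<open>simp\<close>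
  sorts the indices without looping and then finds the value in \<open>sec_basis\<close>.\<close>

lemma sec_sort:
  "i < j \<Longrightarrow> sec s t (v j) (v i) (v k) = - sec s t (v i) (v j) (v k)"
  "j < k \<Longrightarrow> sec s t (v i) (v k) (v j) = - sec s t (v i) (v j) (v k)"
  by (rule form_swap12[OF sec_form], rule form_swap23[OF sec_form])

lemmas sec_eval = sec_basis[unfolded One_nat_def] sec_sort form_zero[OF sec_form]

text \<open>
  The equations say that \<open>\<phi>\<close> kills the 21 directions coming from the basis of the symplectic Lie algebra;
  they are solved in an order in which the pivots are constants, so that no condition on
  \<open>s\<close> and \<open>t\<close> is needed.
\<close>

lemma section_transversal:
  assumes add: "\<And>\<eta> \<zeta>. \<eta> \<in> X \<Longrightarrow> \<zeta> \<in> X \<Longrightarrow> \<phi> (\<lambda>x y z. \<eta> x y z + \<zeta> x y z) = \<phi> \<eta> + \<phi> \<zeta>"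
    and mult: "\<And>c \<eta>. \<eta> \<in> X \<Longrightarrow> \<phi> (\<lambda>x y z. c * \<eta> x y z) = c * (\<phi> \<eta> :: 'f)"
    and orb: "\<And>u. \<phi> (orbit_dir u (sec s t)) = 0"
    and s: "\<phi> (mono 2 3 4) = 0" and t: "\<phi> (mono 4 5 6) = 0"
    and \<theta>: "\<theta> \<in> X"
  shows "\<phi> \<theta> = 0"
proof -
  have ex: "\<phi> \<theta> = (\<Sum>(i, j, k)\<in>tri. \<theta> (v i) (v j) (v k) * \<phi> (mono i j k))" if "\<theta> \<in> X" for \<theta>
    by (rule linear_functional_expand[OF add mult that])
  have orb2: "\<phi> (orbit_dir2 u w (sec s t)) = 0" for u w
  proof -
    let ?M = "\<lambda>u. orbit_dir u (sec s t)"
    have M: "?M u \<in> X" for u by (intro orbit_dir_form sec_form)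
    have "\<phi> (\<lambda>x y z. ?M u x y z + ?M w x y z) = 0"
      by (subst add) (simp_all add: M orb)
    then have "\<phi> (\<lambda>x y z. - 1 * (?M u x y z + ?M w x y z)) = 0"
      by (subst mult) (simp_all add: M form_plus)
    then show ?thesis
      unfolding orbit_dir2_polar[OF sec_form]
      by (subst add) (simp_all only: M orb form_plus form_times add_0)
  qed
  have B: "(\<Sum>(i, j, k)\<in>tri. orbit_dir2 u w (sec s t) (v i) (v j) (v k) * \<phi> (mono i j k)) = 0" for u w
    using ex[OF orbit_dir2_form[OF sec_form], symmetric] orb2 by (rule trans)
  note sim = sum_tri orbit_dir2_def sec_eval Omega_basis_left[unfolded One_nat_def] s t
  have z1: "\<phi> (mono 2 4 6) = 0" using B[of "v 1" "v 1"] by (simp add: sim)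
  have z2: "\<phi> (mono 2 4 5) = 0" using B[of "v 1" "v 3"] by (simp add: sim)
  have z3: "\<phi> (mono 1 2 6) = 0" using B[of "v 1" "v 4"] by (simp add: sim)
  have z4: "\<phi> (mono 3 4 6) = 0" using B[of "v 1" "v 5"] z2 by (simp add: sim)
  have z5: "\<phi> (mono 3 5 6) = 0" using B[of "v 2" "v 3"] z2 z4 by (simp add: sim)
  have z6: "\<phi> (mono 1 4 5) = 0" using B[of "v 2" "v 5"] z3 z5 by (simp add: sim)
  have z7: "\<phi> (mono 2 5 6) = 0" using B[of "v 3" "v 3"] z1 by (simp add: sim)
  have z8: "\<phi> (mono 2 3 5) = 0" using B[of "v 3" "v 6"] z3 by (simp add: sim)
  have z9: "\<phi> (mono 1 3 5) = 0" using B[of "v 4" "v 6"] z5 z6 by (simp add: sim)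
  have z10: "\<phi> (mono 1 3 4) = 0" using B[of "v 5" "v 6"] z2 z4 z8 by (simp add: sim)
  \<comment> \<open>This equation yields only the sum of two unknowns. The sum suffices for
    \<open>z11\<close>, and \<open>z13\<close> separates the two later. The factor 2 comes from the
    diagonal pair.\<close>
  have "2 * (\<phi> (mono 1 2 4) + \<phi> (mono 2 3 6)) = 0"
    using B[of "v 5" "v 5"] z1 by (simp add: sim distrib_left)
  then have e: "\<phi> (mono 1 2 4) + \<phi> (mono 2 3 6) = 0" by (simp only: mult_eq_0_iff) simp
  have z11: "\<phi> (mono 3 4 5) = 0" using B[of "v 1" "v 6"] e by (simp add: sim)
  have z12: "\<phi> (mono 1 4 6) = 0" using B[of "v 1" "v 2"] z7 z11 by (simp add: sim)
  have z13: "\<phi> (mono 2 3 6) = 0" using B[of "v 3" "v 5"] z7 z12 by (simp add: sim)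
  have z14: "\<phi> (mono 1 2 4) = 0" using e z13 by simp
  have z15: "\<phi> (mono 1 5 6) = 0" using B[of "v 2" "v 2"] z11 by (simp add: sim)
  have z16: "\<phi> (mono 1 2 3) = 0" using B[of "v 6" "v 6"] z11 by (simp add: sim)
  have z17: "\<phi> (mono 1 2 5) = 0" using B[of "v 3" "v 4"] z13 z14 z15 by (simp add: sim)
  have z18: "\<phi> (mono 1 3 6) = 0" using B[of "v 2" "v 6"] z17 by (simp add: sim)
  show ?thesis
    using ex[OF \<theta>] s t z1 z2 z3 z4 z5 z6 z7 z8 z9 z10 z11 z12 z13 z14 z15 z16 z17 z18
    by (simp add: sum_tri)
qed

section \<open>Polynomials that vanish on all translates of the plane\<close>

definition vanishing :: "(('v \<Rightarrow> 'v \<Rightarrow> 'v \<Rightarrow> 'f) \<Rightarrow> 'f) \<Rightarrow> bool"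
  where "vanishing D \<longleftrightarrow> D \<in> polynomial_functions scale \<and>
    (\<forall>A\<in>Sp scale \<Omega>. \<forall>s t. D (act A (sec s t)) = 0)"

text \<open>For fixed \<open>A\<close>, the functional sending \<zeta> to the derivative at
  \<open>act A ?M\<close> in direction \<open>act A \<zeta>\<close> is linear. It kills the orbit
  directions and the two plane directions at \<open>?M\<close>, since along those lines
  \<open>D\<close> stays zero. Transversality at \<open>?M\<close> then makes it zero everywhere, in
  particular at the preimage of \<eta> under \<open>act A\<close>.\<close>

lemma vanishing_derivative:
  assumes D: "vanishing D" and dD: "derivation_of D dD" and \<eta>: "\<eta> \<in> X"
  shows "vanishing (dD \<eta>)"
  unfolding vanishing_def
proof (intro conjI ballI allI)
  show "dD \<eta> \<in> polynomial_functions scale"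
    using derivation_ofD(1)[OF dD \<eta>] .
  fix A s t assume A: "A \<in> Sp scale \<Omega>"
  let ?M = "sec s t"
  have M: "act A ?M \<in> X" using act_form[OF A sec_form] .
  have tangent: "dD (act A \<zeta>) (act A ?M) = 0"
    if \<zeta>: "\<zeta> \<in> X" and 0: "\<And>r. D (act A (shift ?M \<zeta> r)) = 0" for \<zeta>
  proof -
    obtain g where g: "\<And>r. poly g r = D (shift (act A ?M) (act A \<zeta>) r)"
      "\<And>r. poly (pderiv g) r = dD (act A \<zeta>) (shift (act A ?M) (act A \<zeta>) r)"
      using derivation_ofD(4)[OF dD M act_form[OF A \<zeta>]] by blast
    \<comment> \<open>The field is infinite, so a polynomial vanishing at all its points is the zero
      polynomial.\<close>
    then have "g = 0"
      using 0 by (simp add: act_shift flip: poly_all_0_iff_0)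
    with g(2)[of 0] show ?thesis
      by (simp add: shift_def)
  qed
  have "dD (act A (act (inv_into UNIV A) \<eta>)) (act A ?M) = 0"
  proof (rule section_transversal[where \<phi> = "\<lambda>\<zeta>. dD (act A \<zeta>) (act A ?M)" and s = s and t = t])
    show "dD (act A (\<lambda>x y z. \<zeta> x y z + \<xi> x y z)) (act A ?M) =
        dD (act A \<zeta>) (act A ?M) + dD (act A \<xi>) (act A ?M)" if "\<zeta> \<in> X" "\<xi> \<in> X" for \<zeta> \<xi>
      using derivation_ofD(2)[OF dD M act_form[OF A that(1)] act_form[OF A that(2)]]
      by (simp add: act_def[abs_def])
    show "dD (act A (\<lambda>x y z. c * \<zeta> x y z)) (act A ?M) = c * dD (act A \<zeta>) (act A ?M)" if "\<zeta> \<in> X" for c \<zeta>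
      using derivation_ofD(3)[OF dD M act_form[OF A that]]
      by (simp add: act_def[abs_def])
    show "dD (act A (orbit_dir u ?M)) (act A ?M) = 0" for u
    proof (rule tangent)
      show "D (act A (shift ?M (orbit_dir u ?M) r)) = 0" for r
        using D A transvection_Sp[of u "- r"]
        by (simp add: vanishing_def Sp_comp flip: act_transvection[OF sec_form] act_comp)
    qed (intro orbit_dir_form sec_form)
    show "dD (act A (mono 2 3 4)) (act A ?M) = 0" "dD (act A (mono 4 5 6)) (act A ?M) = 0"
      using D A by (auto intro!: tangent mono_form simp: sec_shift vanishing_def)
    show "act (inv_into UNIV A) \<eta> \<in> X"
      using act_form[OF Sp_inv[OF A] \<eta>] .
  qed
  moreover have "act A (act (inv_into UNIV A) \<eta>) = \<eta>"
    using SpD(5,6)[OF Sp_inv[OF A]] SpD[OF A]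
    by (simp add: act_def fun_eq_iff inv_inv_eq)
  ultimately show "dD \<eta> (act A ?M) = 0"
    by simp
qed

text \<open>Join \<open>sec 0 0\<close> to \<theta> by a line. The induction is on the degree of the
  restriction \<open>g\<close>, for all vanishing \<open>D\<close> at once, because
  \<open>pderiv g\<close> is the restriction of the vanishing function \<open>dD \<eta>\<close>. In
  characteristic zero a nonconstant \<open>g\<close> has a nonzero derivative, so \<open>g\<close>
  is constant, and its value at the start of the line is 0.\<close>

lemma vanishing_imp_zero:
  assumes D: "vanishing D" and \<theta>: "\<theta> \<in> X"
  shows "D \<theta> = 0"
proof -
  define \<eta> where "\<eta> = shift \<theta> (sec 0 0) (- 1)"
  have \<eta>: "\<eta> \<in> X" unfolding \<eta>_def by (intro shift_form \<theta> sec_form)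
  have id: "id \<in> Sp scale \<Omega>" by (rule SpI[where B = id]) auto
  have *: "\<forall>D. vanishing D \<longrightarrow> (\<forall>r. poly g r = D (shift (sec 0 0) \<eta> r)) \<longrightarrow> g = 0" for g :: "'f poly"
  proof (induction "degree g" arbitrary: g rule: less_induct)
    case less
    show ?case
    proof (intro allI impI)
      fix D assume D: "vanishing D" and g: "\<forall>r. poly g r = D (shift (sec 0 0) \<eta> r)"
      obtain dD where dD: "derivation_of D dD"
        using derivation_exists D unfolding vanishing_def by blast
      obtain h where h: "\<And>r. poly h r = D (shift (sec 0 0) \<eta> r)"
        "\<And>r. poly (pderiv h) r = dD \<eta> (shift (sec 0 0) \<eta> r)"
        using derivation_ofD(4)[OF dD sec_form \<eta>] by blast
      have "h = g"
        using g h(1) by (metis poly_eq_poly_eq_iff ext)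
      have "degree g = 0"
      proof (rule ccontr)
        assume "degree g \<noteq> 0"
        then have "pderiv g = 0"
          using less[of "pderiv g"] vanishing_derivative[OF D dD \<eta>] h(2) \<open>h = g\<close>
          by (simp add: degree_pderiv)
        with \<open>degree g \<noteq> 0\<close> show False by (simp add: pderiv_eq_0_iff)
      qed
      then obtain c where "g = [:c:]" by (rule degree_eq_zeroE)
      \<comment> \<open>The start of the line lies on the plane itself, which is its own translate
        under the identity.\<close>
      moreover have "poly g 0 = D (act id (sec 0 0))"
        using g by (simp add: act_def[abs_def] shift_def)
      ultimately show "g = 0" using D id by (simp add: vanishing_def)
    qed
  qed
  obtain dD where dD: "derivation_of D dD"
    using derivation_exists D unfolding vanishing_def by blast
  obtain g where g: "\<And>r. poly g r = D (shift (sec 0 0) \<eta> r)"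
    using derivation_ofD(4)[OF dD sec_form \<eta>] by blast
  then have "g = 0" using * D by blast
  with g[of 1] show ?thesis by (simp add: shift_def \<eta>_def)
qed

end

section \<open>Permutation sums and alternating forms\<close>

text \<open>Signed sums over a symmetric group by coset decomposition: a permutation of
  \<open>a # xs\<close> is \<open>transpose a b\<close> composed with a permutation of
  \<open>xs\<close>, where \<open>b\<close> is the image of \<open>a\<close>. The summand receives
  the list of images.\<close>

fun alt_sum :: "nat list \<Rightarrow> (nat list \<Rightarrow> 'a::comm_ring_1) \<Rightarrow> 'a"
  where
    "alt_sum [] f = f []"
  | "alt_sum (a # xs) f =
      (\<Sum>b\<leftarrow>a # xs. (if b = a then 1 else - 1) * alt_sum xs (\<lambda>l. f (b # map (transpose a b) l)))"

lemma sum_permutes_eq_alt_sum: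
  "distinct xs \<Longrightarrow> (\<Sum>\<sigma> | \<sigma> permutes set xs. of_int (sign \<sigma>) * f (map \<sigma> xs)) = alt_sum xs f"
proof (induction xs arbitrary: f)
  case Nil
  then show ?case by simp
next
  case (Cons a xs)
  have "(\<Sum>\<sigma> | \<sigma> permutes set (a # xs). of_int (sign \<sigma>) * f (map \<sigma> (a # xs))) =
      (\<Sum>b\<in>set (a # xs). \<Sum>\<sigma> | \<sigma> permutes set xs.
        of_int (sign (transpose a b \<circ> \<sigma>)) * f (map (transpose a b \<circ> \<sigma>) (a # xs)))"
    using Cons.prems by (simp only: list.set, subst sum_over_permutations_insert) auto
  also have "\<dots> = (\<Sum>b\<in>set (a # xs). (if b = a then 1 else - 1) *
      (\<Sum>\<sigma> | \<sigma> permutes set xs. of_int (sign \<sigma>) * f (b # map (transpose a b) (map \<sigma> xs))))"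
  proof (intro sum.cong refl)
    fix b assume "b \<in> set (a # xs)"
    have "of_int (sign (transpose a b \<circ> \<sigma>)) * f (map (transpose a b \<circ> \<sigma>) (a # xs)) =
        (if b = a then 1 else - 1) * (of_int (sign \<sigma>) * f (b # map (transpose a b) (map \<sigma> xs)))"
      if \<sigma>: "\<sigma> permutes set xs" for \<sigma>
    proof -
      \<comment> \<open>Distinctness keeps \<open>a\<close> out of \<open>xs\<close>, so the
        composite sends \<open>a\<close> to \<open>b\<close>, and its sign changes exactly when
        \<open>b\<close> differs from \<open>a\<close>.\<close>
      have "\<sigma> a = a" using \<sigma> Cons.prems by (auto simp: permutes_def)
      moreover have "permutation \<sigma>" using \<sigma> by (auto simp: permutation_permutes)
      ultimately show ?thesis
        by (auto simp: sign_compose permutation_swap_id sign_swap_id)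
    qed
    then show "(\<Sum>\<sigma> | \<sigma> permutes set xs.
          of_int (sign (transpose a b \<circ> \<sigma>)) * f (map (transpose a b \<circ> \<sigma>) (a # xs))) =
        (if b = a then 1 else - 1) *
          (\<Sum>\<sigma> | \<sigma> permutes set xs. of_int (sign \<sigma>) * f (b # map (transpose a b) (map \<sigma> xs)))"
      unfolding sum_distrib_left by (intro sum.cong) auto
  qed
  also have "\<dots> = (\<Sum>b\<in>set (a # xs). (if b = a then 1 else - 1) * alt_sum xs (\<lambda>l. f (b # map (transpose a b) l)))"
    using Cons.prems by (intro sum.cong refl arg_cong2[where f = "(*)"] Cons.IH[of "\<lambda>l. f (_ # map _ l)"]) auto
  finally show ?case
    using Cons.prems by (simp only: sum.distinct_set_conv_list alt_sum.simps)
qed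

section \<open>Alternating functions of a sequence of vectors\<close>

context symplectic_space
begin

text \<open>The slots form an arbitrary index set because exterior products number their arguments
  from 0, while basis indices and the permutations in \<open>I2\<close> start at 1.\<close>

definition multilinear :: "nat set \<Rightarrow> ((nat \<Rightarrow> 'v) \<Rightarrow> 'f) \<Rightarrow> bool"
  where "multilinear S h \<longleftrightarrow> (\<forall>i\<in>S. \<forall>x. lin scale (\<lambda>y. h (x(i := y)))) \<and>
    (\<forall>x x'. (\<forall>i\<in>S. x i = x' i) \<longrightarrow> h x = h x')"

definition alternating :: "nat set \<Rightarrow> ((nat \<Rightarrow> 'v) \<Rightarrow> 'f) \<Rightarrow> bool"
  where "alternating S h \<longleftrightarrow> multilinear S h \<and>
    (\<forall>x. \<forall>i\<in>S. \<forall>j\<in>S. i \<noteq> j \<longrightarrow> x i = x j \<longrightarrow> h x = 0)"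

definition alternation :: "nat set \<Rightarrow> ((nat \<Rightarrow> 'v) \<Rightarrow> 'f) \<Rightarrow> (nat \<Rightarrow> 'v) \<Rightarrow> 'f"
  where "alternation S h x = (\<Sum>\<sigma> | \<sigma> permutes S. of_int (sign \<sigma>) * h (x \<circ> \<sigma>))"

lemma multilinearI:
  assumes "\<And>i x. i \<in> S \<Longrightarrow> lin scale (\<lambda>y. h (x(i := y)))"
    and "\<And>x x'. (\<And>i. i \<in> S \<Longrightarrow> x i = x' i) \<Longrightarrow> h x = h x'"
  shows "multilinear S h"
  unfolding multilinear_def using assms by blast

lemma multilinear_lin: "multilinear S h \<Longrightarrow> i \<in> S \<Longrightarrow> lin scale (\<lambda>y. h (x(i := y)))"
  and multilinear_cong: "multilinear S h \<Longrightarrow> (\<And>i. i \<in> S \<Longrightarrow> x i = x' i) \<Longrightarrow> h x = h x'"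
  unfolding multilinear_def by blast+

lemma alternatingI:
  assumes "multilinear S h"
    and "\<And>x i j. i \<in> S \<Longrightarrow> j \<in> S \<Longrightarrow> i \<noteq> j \<Longrightarrow> x i = x j \<Longrightarrow> h x = 0"
  shows "alternating S h"
  using assms by (auto simp: alternating_def)

lemma alternating_multilinear: "alternating S h \<Longrightarrow> multilinear S h"
  and alternating_zero: "alternating S h \<Longrightarrow> i \<in> S \<Longrightarrow> j \<in> S \<Longrightarrow> i \<noteq> j \<Longrightarrow> x i = x j \<Longrightarrow> h x = 0"
  by (auto simp: alternating_def)

lemma lin_add_fun: "lin scale f \<Longrightarrow> lin scale g \<Longrightarrow> lin scale (\<lambda>x. f x + g x)"
  and lin_times_fun: "lin scale f \<Longrightarrow> lin scale (\<lambda>x. c * f x)"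
  and lin_null: "lin scale (\<lambda>x. 0)"
  by (auto simp: lin_def algebra_simps)

lemma lin_sum_fun: "(\<And>i. i \<in> S \<Longrightarrow> lin scale (f i)) \<Longrightarrow> lin scale (\<lambda>x. \<Sum>i\<in>S. f i x)"
  by (induction S rule: infinite_finite_induct) (auto intro: lin_add_fun lin_null)

lemma alternation_multilinear:
  assumes h: "multilinear S h"
  shows "multilinear S (alternation S h)"
proof (rule multilinearI)
  fix i x assume i: "i \<in> S"
  have "lin scale (\<lambda>y. h (x(i := y) \<circ> \<sigma>))" if \<sigma>: "\<sigma> permutes S" for \<sigma>
  proof -
    \<comment> \<open>Changing entry \<open>i\<close> before permuting changes the single slot that
      \<sigma> sends to \<open>i\<close>.\<close>
    have "x(i := y) \<circ> \<sigma> = (x \<circ> \<sigma>)(inv_into UNIV \<sigma> i := y)" for y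
      using permutes_inverses[OF \<sigma>] by (auto simp: fun_eq_iff)
    moreover have "inv_into UNIV \<sigma> i \<in> S"
      using i permutes_in_image[OF permutes_inv[OF \<sigma>]] by simp
    ultimately show ?thesis
      using multilinear_lin[OF h] by simp
  qed
  then show "lin scale (\<lambda>y. alternation S h (x(i := y)))"
    unfolding alternation_def by (intro lin_sum_fun lin_times_fun) auto
next
  fix x x' :: "nat \<Rightarrow> 'v" assume x: "\<And>i. i \<in> S \<Longrightarrow> x i = x' i"
  have "h (x \<circ> \<sigma>) = h (x' \<circ> \<sigma>)" if \<sigma>: "\<sigma> permutes S" for \<sigma>
    by (rule multilinear_cong[OF h]) (simp add: x permutes_in_image[OF \<sigma>])
  then show "alternation S h x = alternation S h x'"
    unfolding alternation_def by (intro sum.cong) auto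
qed

text \<open>If entries \<open>i\<close> and \<open>j\<close> agree, composing with their
  transposition leaves every summand argument unchanged but flips every sign, so the sum is its own
  negative.\<close>

lemma alternation_alternating:
  assumes h: "multilinear S h" and S: "finite S"
  shows "alternating S (alternation S h)"
proof (rule alternatingI)
  fix x i j assume ij: "i \<in> S" "j \<in> S" "i \<noteq> j" "x i = (x j :: 'v)"
  have *: "x \<circ> (transpose i j \<circ> \<sigma>) = x \<circ> \<sigma>" for \<sigma>
    using ij(4) by (auto simp: fun_eq_iff transpose_def)
  have "alternation S h x =
      (\<Sum>\<sigma> | \<sigma> permutes S. of_int (sign (transpose i j \<circ> \<sigma>)) * h (x \<circ> \<sigma>))"
    unfolding alternation_def
    by (subst setum_permutations_compose_left[OF permutes_swap_id[OF ij(1,2)]]) (simp only: *)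
  also have "\<dots> = (\<Sum>\<sigma> | \<sigma> permutes S. - (of_int (sign \<sigma>) * h (x \<circ> \<sigma>)))"
  proof (intro sum.cong refl)
    fix \<sigma> assume "\<sigma> \<in> {\<sigma>. \<sigma> permutes S}"
    then have "permutation \<sigma>" using S by (auto simp: permutation_permutes)
    then show "of_int (sign (transpose i j \<circ> \<sigma>)) * h (x \<circ> \<sigma>) = - (of_int (sign \<sigma>) * h (x \<circ> \<sigma>))"
      using ij(3) by (simp add: sign_compose permutation_swap_id sign_swap_id)
  qed
  also have "\<dots> = - alternation S h x"
    by (simp add: alternation_def sum_negf)
  finally show "alternation S h x = 0"
    by simp
qed (rule alternation_multilinear[OF h])

lemma alternating_swap:
  assumes h: "alternating S h" and ij: "i \<in> S" "j \<in> S" "i \<noteq> j"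
  shows "h (x \<circ> transpose i j) = - h x"
proof -
  let ?h = "\<lambda>a b. h (x(i := a, j := b))"
  have add: "?h (a + a') b = ?h a b + ?h a' b" "?h b (a + a') = ?h b a + ?h b a'" for a a' b
  proof -
    have "lin scale (\<lambda>y. h ((x(j := b))(i := y)))" "lin scale (\<lambda>y. h ((x(i := b))(j := y)))"
      by (intro multilinear_lin[OF alternating_multilinear[OF h]] ij)+
    then show "?h (a + a') b = ?h a b + ?h a' b" "?h b (a + a') = ?h b a + ?h b a'"
      using ij(3) by (auto simp: lin_def fun_upd_twist)
  qed
  have zero: "?h a a = 0" for a
    by (rule alternating_zero[OF h ij]) (use ij(3) in auto)
  have "?h (x j) (x i) + ?h (x i) (x j) = ?h (x i + x j) (x i + x j)"
    unfolding add by (simp only: zero add_0_left add_0_right)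
  then have "?h (x j) (x i) = - ?h (x i) (x j)"
    by (simp only: zero eq_neg_iff_add_eq_0)
  moreover have "x \<circ> transpose i j = x(i := x j, j := x i)"
    by (auto simp: fun_eq_iff transpose_def)
  ultimately show ?thesis by simp
qed

text \<open>Only vanishing is carried through the induction over transpositions, which avoids all
  bookkeeping of signs.\<close>

lemma alternating_permute_0:
  assumes h: "alternating S h" and S: "finite S" and \<sigma>: "\<sigma> permutes S"
  shows "h x = 0 \<Longrightarrow> h (x \<circ> \<sigma>) = 0"
  using \<sigma> S
proof (induction arbitrary: x rule: permutes_induct)
  case (swap a b p)
  then have "h (x \<circ> transpose a b) = 0"
    using alternating_swap[OF h, of a b x] by simp
  then have "h ((x \<circ> transpose a b) \<circ> p) = 0"
    by (rule swap.IH)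
  then show ?case by (simp only: comp_assoc)
qed simp

text \<open>Two enumerations of the same index set by \<open>S\<close> differ by a permutation of
  \<open>S\<close>, extended by the identity outside \<open>S\<close>.\<close>

lemma alternating_bij_0:
  assumes h: "alternating S h" and S: "finite S" and g: "bij_betw g S A" and f: "bij_betw f S A"
    and 0: "h (x \<circ> g) = 0"
  shows "h (x \<circ> f) = 0"
proof -
  define \<sigma> where "\<sigma> i = (if i \<in> S then inv_into S g (f i) else i)" for i
  have "bij_betw (inv_into S g \<circ> f) S S"
    by (rule bij_betw_trans[OF f bij_betw_inv_into[OF g]])
  then have "bij_betw \<sigma> S S"
    by (rule bij_betw_cong[THEN iffD1, rotated]) (auto simp: \<sigma>_def)
  then have "\<sigma> permutes S"
    by (rule bij_imp_permutes) (auto simp: \<sigma>_def)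
  then have "h (x \<circ> g \<circ> \<sigma>) = 0"
    using alternating_permute_0[OF h S] 0 by blast
  moreover have "(x \<circ> g \<circ> \<sigma>) i = (x \<circ> f) i" if "i \<in> S" for i
    using that f g by (auto simp: \<sigma>_def bij_betw_def f_inv_into_f)
  then have "h (x \<circ> g \<circ> \<sigma>) = h (x \<circ> f)"
    by (rule multilinear_cong[OF alternating_multilinear[OF h]])
  ultimately show ?thesis by simp
qed

text \<open>Induction on the set \<open>T\<close> of slots whose entry may still be an arbitrary
  vector: expanding one such entry in the basis shrinks \<open>T\<close>. When only basis vectors
  remain, a repeated index gives zero directly.\<close>

lemma alternating_eq_0I:
  assumes h: "alternating S h" and S: "finite S"
    and 0: "\<And>f. inj_on f S \<Longrightarrow> f ` S \<subseteq> {1..6} \<Longrightarrow> h (v \<circ> f) = 0"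
  shows "h x = 0"
proof -
  have "T \<subseteq> S \<Longrightarrow> \<forall>i\<in>S - T. \<exists>k\<in>{1..6}. x i = v k \<Longrightarrow> h x = 0" if "finite T" for T
    using that
  proof (induction T arbitrary: x)
    case empty
    then obtain f where f: "\<forall>i\<in>S. f i \<in> {1..6} \<and> x i = v (f i)"
      by (metis Diff_empty)
    then have "h x = h (v \<circ> f)"
      by (intro multilinear_cong[OF alternating_multilinear[OF h]]) simp
    moreover have "h x = 0" if ninj: "\<not> inj_on f S"
    proof -
      obtain i j where "i \<in> S" "j \<in> S" "i \<noteq> j" "f i = f j"
        using ninj by (auto simp: inj_on_def)
      with f show ?thesis by (intro alternating_zero[OF h, of i j]) auto
    qed
    moreover have "h (v \<circ> f) = 0" if "inj_on f S"
      using f by (intro 0 that) auto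
    ultimately show ?case by (cases "inj_on f S") simp_all
  next
    case (insert i T)
    have "lin scale (\<lambda>y. h (x(i := y)))"
      using insert.prems by (intro multilinear_lin[OF alternating_multilinear[OF h]]) auto
    from lin_expand[OF this, of "x i"]
    have "h x = (\<Sum>k = 1..6. co k (x i) * h (x(i := v k)))" by simp
    also have "\<dots> = 0"
      using insert by (intro sum.neutral ballI mult_eq_0_iff[THEN iffD2] disjI2 insert.IH) auto
    finally show ?case .
  qed
  from this[OF S] show ?thesis by auto
qed

lemma alternating6_eq_0I:
  assumes h: "alternating {1..6} h" and 0: "h v = 0"
  shows "h x = 0"
proof (rule alternating_eq_0I[OF h])
  fix f :: "nat \<Rightarrow> nat" assume f: "inj_on f {1..6}" "f ` {1..6} \<subseteq> {1..6}"
  have "f ` {1..6} = {1..6}"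
    by (intro card_subset_eq f) (simp_all only: card_image[OF f(1)] finite_atLeastAtMost)
  with f have bf: "bij_betw f {1..6} {1..6}"
    by (simp add: bij_betw_def)
  from alternating_bij_0[OF h _ bij_betw_id bf, of v] show "h (v \<circ> f) = 0"
    by (simp add: 0)
qed simp

text \<open>The increasing enumeration of \<open>{1..6} - {j}\<close>, starting at index 0.\<close>

definition skip :: "nat \<Rightarrow> nat \<Rightarrow> nat"
  where "skip j i = (if i + 1 < j then i + 1 else i + 2)"

text \<open>An injective choice of five indices out of six misses exactly one index
  \<open>j\<close>, and hence is a reordering of \<open>skip j\<close>.\<close>

lemma alternating5_eq_0I:
  assumes h: "alternating {..<5} h" and 0: "\<And>j. j \<in> {1..6} \<Longrightarrow> h (v \<circ> skip j) = 0"
  shows "h x = 0"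
proof (rule alternating_eq_0I[OF h])
  fix f :: "nat \<Rightarrow> nat" assume f: "inj_on f {..<5}" "f ` {..<5} \<subseteq> {1..6}"
  then have "card ({1..6} - f ` {..<5}) = 1"
    by (simp add: card_Diff_subset card_image)
  then obtain j where j: "{1..6} - f ` {..<5} = {j}" by (auto simp: card_1_singleton_iff)
  then have "f ` {..<5} = {1..6} - {j}" and j6: "j \<in> {1..6}" using f(2) by auto
  then have bf: "bij_betw f {..<5} ({1..6} - {j})" using f(1) by (simp add: bij_betw_def)
  have "inj_on (skip j) {..<5}" by (auto simp: inj_on_def skip_def split: if_splits)
  moreover have "skip j ` {..<5} \<subseteq> {1..6} - {j}" by (auto simp: skip_def)
  moreover have "card (skip j ` {..<5}) = card ({1..6} - {j})"
    using j6 calculation(1) by (simp add: card_image)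
  ultimately have "bij_betw (skip j) {..<5} ({1..6} - {j})"
    unfolding bij_betw_def by (metis card_subset_eq finite_Diff finite_atLeastAtMost)
  from alternating_bij_0[OF h _ this bf] show "h (v \<circ> f) = 0"
    using 0[OF j6] by simp
qed simp

lemma insertion_alternating:
  assumes h: "alternating {..<Suc n} h"
  shows "alternating {..<n} (insertion u h)"
proof (intro alternatingI multilinearI)
  fix i x assume i: "i \<in> {..<n}"
  have "case_nat u (x(i := y)) = (case_nat u x)(Suc i := y)" for y
    by (auto simp: fun_eq_iff split: nat.split)
  then show "lin scale (\<lambda>y. insertion u h (x(i := y)))"
    using multilinear_lin[OF alternating_multilinear[OF h], of "Suc i" "case_nat u x"] i
    by (simp add: insertion_def)
next
  fix x x' :: "nat \<Rightarrow> 'v" assume "\<And>i. i \<in> {..<n} \<Longrightarrow> x i = x' i"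
  then show "insertion u h x = insertion u h x'"
    unfolding insertion_def
    by (intro multilinear_cong[OF alternating_multilinear[OF h]]) (auto split: nat.split)
next
  fix x i j assume "i \<in> {..<n}" "j \<in> {..<n}" "i \<noteq> j" "x i = (x j :: 'v)"
  then show "insertion u h x = 0"
    unfolding insertion_def by (intro alternating_zero[OF h, of "Suc i" "Suc j"]) auto
qed

lemma multilinear_mult:
  assumes a: "multilinear {..<p} \<alpha>" and b: "multilinear {..<q} \<beta>"
  shows "multilinear {..<p + q} (\<lambda>x. \<alpha> x * \<beta> (\<lambda>i. x (p + i)))"
proof (rule multilinearI)
  fix k x assume k: "k \<in> {..<p + q}"
  show "lin scale (\<lambda>y. \<alpha> (x(k := y)) * \<beta> (\<lambda>i. (x(k := y)) (p + i)))"
  proof (cases "k < p")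
    case True
    then have "(\<lambda>i. (x(k := y)) (p + i)) = (\<lambda>i. x (p + i))" for y
      by auto
    then have "(\<lambda>y. \<alpha> (x(k := y)) * \<beta> (\<lambda>i. (x(k := y)) (p + i))) =
        (\<lambda>y. \<beta> (\<lambda>i. x (p + i)) * \<alpha> (x(k := y)))"
      by (simp add: mult.commute)
    with True show ?thesis
      using lin_times_fun[OF multilinear_lin[OF a]] by simp
  next
    case False
    then have "\<alpha> (x(k := y)) = \<alpha> x" for y
      by (intro multilinear_cong[OF a]) auto
    moreover have "(\<lambda>i. (x(k := y)) (p + i)) = (\<lambda>i. x (p + i))(k - p := y)" for y
      using False by (auto simp: fun_eq_iff)
    moreover have "k - p \<in> {..<q}" using k False by auto
    ultimately show ?thesis
      using lin_times_fun[OF multilinear_lin[OF b]] by simp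
  qed
next
  fix x x' :: "nat \<Rightarrow> 'v" assume x: "\<And>i. i \<in> {..<p + q} \<Longrightarrow> x i = x' i"
  show "\<alpha> x * \<beta> (\<lambda>i. x (p + i)) = \<alpha> x' * \<beta> (\<lambda>i. x' (p + i))"
    by (intro arg_cong2[where f = "(*)"] multilinear_cong[OF a] multilinear_cong[OF b]) (auto intro: x)
qed

lemma wedge_alternation:
  "wedge p q \<alpha> \<beta> x = 1 / (fact p * fact q) * alternation {..<p + q} (\<lambda>x. \<alpha> x * \<beta> (\<lambda>i. x (p + i))) x"
  by (simp add: wedge_def alternation_def o_def mult.assoc)

lemma alternating_times:
  assumes "alternating S h" shows "alternating S (\<lambda>x. c * h x)"
  using alternating_zero[OF assms]
  by (intro alternatingI multilinearI lin_times_fun multilinear_lin[OF alternating_multilinear[OF assms]]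
      arg_cong2[where f = "(*)"] multilinear_cong[OF alternating_multilinear[OF assms]]) auto

lemma alternating_add:
  assumes "alternating S h" "alternating S g" shows "alternating S (\<lambda>x. h x + g x)"
  using alternating_zero[OF assms(1)] alternating_zero[OF assms(2)]
  by (intro alternatingI multilinearI lin_add_fun multilinear_lin[OF alternating_multilinear[OF assms(1)]]
      multilinear_lin[OF alternating_multilinear[OF assms(2)]]
      arg_cong2[where f = "(+)"] multilinear_cong[OF alternating_multilinear[OF assms(1)]]
      multilinear_cong[OF alternating_multilinear[OF assms(2)]]) auto

lemma wedge_alternating:
  "multilinear {..<p} \<alpha> \<Longrightarrow> multilinear {..<q} \<beta> \<Longrightarrow> alternating {..<p + q} (wedge p q \<alpha> \<beta>)"
  unfolding wedge_alternation[abs_def]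
  by (intro alternating_times alternation_alternating multilinear_mult) auto

lemma form2_multilinear: "multilinear {..<2} (form2 \<Omega>)"
  by (auto simp: multilinear_def form2_def lin_def less_2_cases_iff numeral_2_eq_2 lessThan_Suc)

lemma form3_multilinear:
  assumes "\<theta> \<in> X"
  shows "multilinear {..<3} (form3 \<theta>)"
  using form_add[OF assms] form_scale[OF assms]
  by (auto simp: multilinear_def form3_def lin_def numeral_3_eq_3 numeral_2_eq_2 lessThan_Suc)

end

text \<open>
  With the congruence rules below, the simplifier evaluates alternating sums over concrete lists
  without rewriting the summand before all its arguments are known.
\<close>

declare alt_sum.simps(2) [simp del]

text \<open>Conjugation by \<open>\<tau>\<close> turns \<open>transpose a b\<close> into
  \<open>transpose (\<tau> a) (\<tau> b)\<close>. This moves a transposition from the arguments of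
  the summand to the list of remaining entries, where it computes on numerals.\<close>

lemma alt_sum_map:
  assumes "inj \<tau>"
  shows "alt_sum (map \<tau> xs) f = alt_sum xs (\<lambda>l. f (map \<tau> l))"
proof (induction xs arbitrary: f)
  case (Cons a xs)
  have "transpose (\<tau> a) (\<tau> b) \<circ> \<tau> = \<tau> \<circ> transpose a b" for b
    using assms by (auto simp: fun_eq_iff transpose_def inj_eq)
  then show ?case
    using assms by (simp add: alt_sum.simps Cons.IH inj_eq o_def)
qed simp

definition alt_prefix :: "nat list \<Rightarrow> nat list \<Rightarrow> (nat list \<Rightarrow> 'a::comm_ring_1) \<Rightarrow> 'a"
  where "alt_prefix p xs f = alt_sum xs (\<lambda>l. f (p @ l))"

definition alt_step :: "nat list \<Rightarrow> nat \<Rightarrow> nat list \<Rightarrow> (nat list \<Rightarrow> 'a::comm_ring_1) \<Rightarrow> nat list \<Rightarrow> 'a"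
  where "alt_step p a xs f bs =
    (\<Sum>b\<leftarrow>bs. (if b = a then 1 else - 1) * alt_sum xs (\<lambda>l. f (p @ b # map (transpose a b) l)))"

lemma alt_eval:
  "alt_prefix p [] f = f p"
  "alt_prefix p (a # xs) f = alt_step p a xs f (a # xs)"
  "alt_step p a xs f [] = 0"
  "alt_step p a xs f (b # bs) =
    (if b = a then alt_prefix (p @ [b]) xs f
     else - alt_prefix (p @ [b]) (map (transpose a b) xs) f) + alt_step p a xs f bs"
  by (simp_all add: alt_step_def alt_prefix_def alt_sum.simps alt_sum_map)

lemma alt_prefix_cong: "p = q \<Longrightarrow> xs = ys \<Longrightarrow> alt_prefix p xs f = alt_prefix q ys f"
  and alt_step_cong: "p = q \<Longrightarrow> a = b \<Longrightarrow> xs = ys \<Longrightarrow> bs = cs \<Longrightarrow> alt_step p a xs f bs = alt_step q b ys f cs"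
  by auto

lemma alt_sum_prefix: "alt_sum xs f = alt_prefix [] xs f"
  by (simp add: alt_prefix_def)

lemma alt_sum_times: "alt_sum xs (\<lambda>l. c * f l) = c * alt_sum xs f"
  by (induction xs arbitrary: f) (simp_all add: alt_sum.simps algebra_simps flip: sum_list_const_mult)

text \<open>When the summand is a product of a function of the first two entries and a function of
  the rest, the inner alternation acts on the second factor alone. In degree 6 this leaves 30 inner
  sums instead of 720 separate terms.\<close>

lemma alt_sum_factor:
  "alt_sum (a # c # xs) (\<lambda>l. g (l ! 0) (l ! 1) * h (drop 2 l)) =
    (\<Sum>b\<leftarrow>a # c # xs. (if b = a then 1 else - 1) * (\<Sum>d\<leftarrow>c # xs. (if d = c then 1 else - 1) *
      (g b (transpose a b d) *
      alt_prefix [] (map (transpose a b) (map (transpose c d) xs)) h)))"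
  unfolding alt_sum.simps(2)
  by (intro arg_cong[where f = sum_list] map_cong refl arg_cong2[where f = "(*)"])
    (simp add: alt_sum_times alt_sum_map numeral_2_eq_2 flip: alt_sum_prefix del: map_map)

context symplectic_space
begin

section \<open>The vector \<open>v\<^sub>\<theta>\<close> and the map \<open>J\<close>\<close>

abbreviation vol :: "(nat \<Rightarrow> 'v) \<Rightarrow> 'f"
  where "vol \<equiv> wedge 4 2 (wedge 2 2 (form2 \<Omega>) (form2 \<Omega>)) (form2 \<Omega>)"

lemma upto_sets:
  "{..<4::nat} = set [0, 1, 2, 3]" "{..<5::nat} = set [0, 1, 2, 3, 4]" "{..<6::nat} = set [0, 1, 2, 3, 4, 5]"
  by auto

text \<open>A conditional form of antisymmetry that terminates as a rewrite rule on
  numerals.\<close>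

lemma Omega_sort: "i < j \<Longrightarrow> \<Omega> (x j) (x i) = - \<Omega> (x i) (x j)" for x :: "nat \<Rightarrow> 'v"
  by (rule Omega_swap)

text \<open>The bracket is a Pfaffian with three matchings. Each matching arises from 8 of the 24
  permutations, and the normalization 1/4 leaves the factor 2.\<close>

lemma wedge_Omega_Omega:
  "wedge 2 2 (form2 \<Omega>) (form2 \<Omega>) x =
    2 * (\<Omega> (x 0) (x 1) * \<Omega> (x 2) (x 3) - \<Omega> (x 0) (x 2) * \<Omega> (x 1) (x 3) + \<Omega> (x 0) (x 3) * \<Omega> (x 1) (x 2))"
proof -
  let ?f = "\<lambda>l. \<Omega> (x (l ! 0)) (x (l ! 1)) * \<Omega> (x (l ! 2)) (x (l ! 3))"
  have "wedge 2 2 (form2 \<Omega>) (form2 \<Omega>) x =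
      (\<Sum>\<sigma> | \<sigma> permutes {..<4}. of_int (sign \<sigma>) * ?f (map \<sigma> [0, 1, 2, 3])) / 4"
    by (simp add: wedge_def form2_def mult.assoc eval_nat_numeral)
  also have "\<dots> = alt_sum [0, 1, 2, 3] ?f / 4"
    by (subst upto_sets, subst sum_permutes_eq_alt_sum) auto
  also have "\<dots> = 2 * (\<Omega> (x 0) (x 1) * \<Omega> (x 2) (x 3) - \<Omega> (x 0) (x 2) * \<Omega> (x 1) (x 3) + \<Omega> (x 0) (x 3) * \<Omega> (x 1) (x 2))"
    by (simp add: alt_sum_prefix alt_eval transpose_def Omega_sort[of _ _ x] cong: alt_prefix_cong alt_step_cong)
  finally show ?thesis .
qed

text \<open>The ten terms are the ways to split five slots into three and two. Each arises from 3!
  2! = 12 permutations, which the normalization cancels.\<close>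

lemma wedge_form_Omega:
  assumes \<theta>: "\<theta> \<in> X"
  shows "wedge 3 2 (form3 \<theta>) (form2 \<Omega>) x =
    \<theta> (x 0) (x 1) (x 2) * \<Omega> (x 3) (x 4) - \<theta> (x 0) (x 1) (x 3) * \<Omega> (x 2) (x 4) +
    \<theta> (x 0) (x 1) (x 4) * \<Omega> (x 2) (x 3) + \<theta> (x 0) (x 2) (x 3) * \<Omega> (x 1) (x 4) -
    \<theta> (x 0) (x 2) (x 4) * \<Omega> (x 1) (x 3) + \<theta> (x 0) (x 3) (x 4) * \<Omega> (x 1) (x 2) -
    \<theta> (x 1) (x 2) (x 3) * \<Omega> (x 0) (x 4) + \<theta> (x 1) (x 2) (x 4) * \<Omega> (x 0) (x 3) -
    \<theta> (x 1) (x 3) (x 4) * \<Omega> (x 0) (x 2) + \<theta> (x 2) (x 3) (x 4) * \<Omega> (x 0) (x 1)" (is "_ = ?R")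
proof -
  have sw: "i < j \<Longrightarrow> \<theta> (x j) (x i) z = - \<theta> (x i) (x j) z"
    "i < j \<Longrightarrow> \<theta> z (x j) (x i) = - \<theta> z (x i) (x j)" for i j z
    by (rule form_swap12[OF \<theta>], rule form_swap23[OF \<theta>])
  let ?f = "\<lambda>l. \<theta> (x (l ! 0)) (x (l ! 1)) (x (l ! 2)) * \<Omega> (x (l ! 3)) (x (l ! 4))"
  have "wedge 3 2 (form3 \<theta>) (form2 \<Omega>) x =
      (\<Sum>\<sigma> | \<sigma> permutes {..<5}. of_int (sign \<sigma>) * ?f (map \<sigma> [0, 1, 2, 3, 4])) / 12"
    by (simp add: wedge_def form2_def form3_def mult.assoc fact_numeral)
  also have "\<dots> = alt_sum [0, 1, 2, 3, 4] ?f / 12"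
    by (subst upto_sets, subst sum_permutes_eq_alt_sum) auto
  also have "alt_sum [0, 1, 2, 3, 4] ?f = 12 * ?R"
    by (simp add: alt_sum_prefix alt_eval transpose_def Omega_sort[of _ _ x] sw cong: alt_prefix_cong alt_step_cong)
  also have "12 * ?R / 12 = ?R"
    by (rule nonzero_mult_div_cancel_left) simp
  finally show ?thesis .
qed

text \<open>The bracket is the Pfaffian of the 6 by 6 matrix of values of \<Omega>, expanded along
  its first row; the factor is 3!, as for the cube of any 2-form.\<close>

lemma vol_eq:
  "vol x = 6 * (
    \<Omega> (x 0) (x 1) * (\<Omega> (x 2) (x 3) * \<Omega> (x 4) (x 5) - \<Omega> (x 2) (x 4) * \<Omega> (x 3) (x 5) + \<Omega> (x 2) (x 5) * \<Omega> (x 3) (x 4)) -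
    \<Omega> (x 0) (x 2) * (\<Omega> (x 1) (x 3) * \<Omega> (x 4) (x 5) - \<Omega> (x 1) (x 4) * \<Omega> (x 3) (x 5) + \<Omega> (x 1) (x 5) * \<Omega> (x 3) (x 4)) +
    \<Omega> (x 0) (x 3) * (\<Omega> (x 1) (x 2) * \<Omega> (x 4) (x 5) - \<Omega> (x 1) (x 4) * \<Omega> (x 2) (x 5) + \<Omega> (x 1) (x 5) * \<Omega> (x 2) (x 4)) -
    \<Omega> (x 0) (x 4) * (\<Omega> (x 1) (x 2) * \<Omega> (x 3) (x 5) - \<Omega> (x 1) (x 3) * \<Omega> (x 2) (x 5) + \<Omega> (x 1) (x 5) * \<Omega> (x 2) (x 3)) +
    \<Omega> (x 0) (x 5) * (\<Omega> (x 1) (x 2) * \<Omega> (x 3) (x 4) - \<Omega> (x 1) (x 3) * \<Omega> (x 2) (x 4) + \<Omega> (x 1) (x 4) * \<Omega> (x 2) (x 3)))"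
  (is "_ = 6 * ?R")
proof -
  let ?W = "\<lambda>l. \<Omega> (x (l ! 0)) (x (l ! 1)) * \<Omega> (x (l ! 2)) (x (l ! 3))
      - \<Omega> (x (l ! 0)) (x (l ! 2)) * \<Omega> (x (l ! 1)) (x (l ! 3))
      + \<Omega> (x (l ! 0)) (x (l ! 3)) * \<Omega> (x (l ! 1)) (x (l ! 2))"
  let ?f = "\<lambda>l. \<Omega> (x (l ! 0)) (x (l ! 1)) * ?W (drop 2 l)"
  \<comment> \<open>The slots 4 and 5 of the last factor come first, so that the summand has the
    shape required by \<open>alt_sum_factor\<close>.\<close>
  have set: "{..<4 + 2::nat} = set [4, 5, 0, 1, 2, 3]"
    by auto
  \<comment> \<open>\<open>?W\<close> is already antisymmetric, so all 24 signed terms of its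
    alternation are equal.\<close>
  have W: "alt_prefix [] [i, j, k, l] ?W = 24 * ?W [i, j, k, l]" if "distinct [i, j, k, l]" for i j k l
  proof -
    have ne: "i \<noteq> j" "i \<noteq> k" "i \<noteq> l" "j \<noteq> k" "j \<noteq> l" "k \<noteq> l"
      using that by auto
    show ?thesis
      using ne ne[symmetric]
      by (simp add: alt_eval transpose_def Omega_swap[of "x j" "x i"] Omega_swap[of "x k" "x i"]
          Omega_swap[of "x l" "x i"] Omega_swap[of "x k" "x j"] Omega_swap[of "x l" "x j"]
          Omega_swap[of "x l" "x k"] algebra_simps cong: alt_prefix_cong alt_step_cong)
  qed
  have "vol x = (\<Sum>\<sigma> | \<sigma> permutes set [4, 5, 0, 1, 2, 3]. 2 * (of_int (sign \<sigma>) * ?f (map \<sigma> [4, 5, 0, 1, 2, 3]))) / 48"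
    unfolding wedge_def[of 4 2] wedge_Omega_Omega form2_def set
    by (intro arg_cong2[where f = "(/)"] sum.cong refl) (simp_all add: fact_numeral ac_simps)
  also have "\<dots> = (2 * alt_sum [4, 5, 0, 1, 2, 3] ?f) / 48"
    unfolding sum_distrib_left[symmetric] by (subst sum_permutes_eq_alt_sum) auto
  \<comment> \<open>720 permutations with three terms each are shared equally by the 15 matchings,
    whence 144.\<close>
  also have "alt_sum [4, 5, 0, 1, 2, 3] ?f = 144 * ?R"
    unfolding alt_sum_factor[of 4 5 "[0, 1, 2, 3]" "\<lambda>b d. \<Omega> (x b) (x d)" ?W]
    by (simp add: W transpose_def Omega_sort[of _ _ x] algebra_simps del: One_nat_def cong: alt_prefix_cong)
  also have "2 * (144 * ?R) / 48 = 6 * ?R"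
    by (simp only: mult.assoc[symmetric]) (simp del: One_nat_def)
  finally show ?thesis .
qed

text \<open>Only the \<open>v j\<close> component of \<open>u\<close> survives. Moving it to
  position \<open>j\<close> contributes a sign \<open>(- 1) ^ (j - 1)\<close>, and the volume of the
  basis in its given order is -6 because pairing \<open>i\<close> with \<open>i + 3\<close> is an
  odd reordering.\<close>

lemma insertion_vol:
  assumes "j \<in> {1..6}"
  shows "insertion u vol (v \<circ> skip j) = 6 * (- 1) ^ j * co j u"
  using assms unfolding Icc16
  by (elim insertE emptyE) (simp_all add: insertion_def vol_eq skip_def numeral_2_eq_2[symmetric] Omega_basis_left[unfolded One_nat_def]
      Omega_basis_right[unfolded One_nat_def])

lemma vol_alternating: "alternating {..<6} vol"
  using wedge_alternating[OF alternating_multilinear[OF wedge_alternating[OF form2_multilinear form2_multilinear]]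
      form2_multilinear]
  by simp

definition contraction :: "('v \<Rightarrow> 'v \<Rightarrow> 'v \<Rightarrow> 'f) \<Rightarrow> 'v \<Rightarrow> 'f"
  where "contraction \<theta> y = \<theta> (v 1) (v 4) y + \<theta> (v 2) (v 5) y + \<theta> (v 3) (v 6) y"

text \<open>In invariant terms, \<open>\<Omega> u y = contraction \<theta> y / 6\<close>; the 6
  cancels the factor in \<open>insertion_vol\<close>.\<close>

lemma contraction_vector:
  "\<exists>u. co 1 u = contraction \<theta> (v 4) / 6 \<and> co 2 u = contraction \<theta> (v 5) / 6 \<and> co 3 u = contraction \<theta> (v 6) / 6 \<and>
    co 4 u = - contraction \<theta> (v 1) / 6 \<and> co 5 u = - contraction \<theta> (v 2) / 6 \<and> co 6 u = - contraction \<theta> (v 3) / 6"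
  by (rule exI[of _ "scale (contraction \<theta> (v 4) / 6) (v 1) + scale (contraction \<theta> (v 5) / 6) (v 2) +
      scale (contraction \<theta> (v 6) / 6) (v 3) + scale (- contraction \<theta> (v 1) / 6) (v 4) +
      scale (- contraction \<theta> (v 2) / 6) (v 5) + scale (- contraction \<theta> (v 3) / 6) (v 6)"]) simp

lemma insertion_vol_unique:
  assumes "insertion u vol = insertion u' vol"
  shows "u = u'"
  by (rule co_eqI) (use insertion_vol[of _ u] insertion_vol[of _ u'] assms in auto)

text \<open>Both sides are alternating in five slots, so a comparison on the six tuples that omit
  one basis vector decides.\<close>

lemma insertion_vol_eq_wedge:
  assumes \<theta>: "\<theta> \<in> X"
    and u: "co 1 u = contraction \<theta> (v 4) / 6" "co 2 u = contraction \<theta> (v 5) / 6" "co 3 u = contraction \<theta> (v 6) / 6"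
      "co 4 u = - contraction \<theta> (v 1) / 6" "co 5 u = - contraction \<theta> (v 2) / 6" "co 6 u = - contraction \<theta> (v 3) / 6"
  shows "insertion u vol = wedge 3 2 (form3 \<theta>) (form2 \<Omega>)"
proof
  fix x
  let ?h = "\<lambda>x. insertion u vol x + - 1 * wedge 3 2 (form3 \<theta>) (form2 \<Omega>) x"
  have "alternating {..<5} (insertion u vol)"
    using insertion_alternating[of 5] vol_alternating by simp
  moreover have "alternating {..<5} (wedge 3 2 (form3 \<theta>) (form2 \<Omega>))"
    using wedge_alternating[OF form3_multilinear[OF \<theta>] form2_multilinear] by simp
  ultimately have h: "alternating {..<5} ?h"
    by (intro alternating_add alternating_times)
  have sw: "i < j \<Longrightarrow> \<theta> (v j) (v i) z = - \<theta> (v i) (v j) z"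
    "i < j \<Longrightarrow> \<theta> z (v j) (v i) = - \<theta> z (v i) (v j)" for i j z
    by (rule form_swap12[OF \<theta>], rule form_swap23[OF \<theta>])
  have "?h (v \<circ> skip j) = 0" if "j \<in> {1..6}" for j
    unfolding insertion_vol[OF that] wedge_form_Omega[OF \<theta>]
    using that unfolding Icc16
    by (elim insertE emptyE) (simp_all add: u[unfolded One_nat_def] skip_def numeral_2_eq_2[symmetric]
        Omega_basis_left[unfolded One_nat_def] contraction_def sw form_zero[OF \<theta>] add_divide_distrib diff_divide_distrib)
  from alternating5_eq_0I[OF h this, of x]
  show "insertion u vol x = wedge 3 2 (form3 \<theta>) (form2 \<Omega>) x" by simp
qed

lemma vtheta_iff:
  assumes "\<theta> \<in> X"
  shows "insertion u vol = wedge 3 2 (form3 \<theta>) (form2 \<Omega>) \<longleftrightarrow> u = vtheta \<Omega> \<theta>"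
proof -
  obtain w where w: "insertion w vol = wedge 3 2 (form3 \<theta>) (form2 \<Omega>)"
    using contraction_vector[of \<theta>] insertion_vol_eq_wedge[OF assms] by blast
  moreover have "w = vtheta \<Omega> \<theta>"
    unfolding vtheta_def using w by (intro the_equality[symmetric]) (auto intro: insertion_vol_unique)
  ultimately show ?thesis
    using insertion_vol_unique by metis
qed

lemma co_vtheta:
  assumes "\<theta> \<in> X"
  shows "co 1 (vtheta \<Omega> \<theta>) = contraction \<theta> (v 4) / 6" "co 2 (vtheta \<Omega> \<theta>) = contraction \<theta> (v 5) / 6"
    "co 3 (vtheta \<Omega> \<theta>) = contraction \<theta> (v 6) / 6" "co 4 (vtheta \<Omega> \<theta>) = - contraction \<theta> (v 1) / 6"
    "co 5 (vtheta \<Omega> \<theta>) = - contraction \<theta> (v 2) / 6" "co 6 (vtheta \<Omega> \<theta>) = - contraction \<theta> (v 3) / 6"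
  using contraction_vector[of \<theta>] insertion_vol_eq_wedge[OF assms] vtheta_iff[OF assms] by metis+

lemma Omega_0_left [simp]: "\<Omega> 0 y = 0"
  by (simp add: Omega_explicit)

lemma Jmap:
  assumes \<theta>: "\<theta> \<in> X"
  shows Jmap_bilinear: "alternating_bilinear scale scale (Jmap scale \<Omega> \<theta>)"
    and Omega_Jmap: "\<Omega> (Jmap scale \<Omega> \<theta> x y) z = \<theta> x y z"
proof -
  \<comment> \<open>The coefficients are forced: pairing with \<open>v 4\<close>,
    \<open>v 5\<close>, \<open>v 6\<close> reads off coordinates 1, 2, 3, and pairing with
    \<open>v 1\<close>, \<open>v 2\<close>, \<open>v 3\<close> reads off the negatives of
    coordinates 4, 5, 6.\<close>
  define J where "J x y = scale (\<theta> x y (v 4)) (v 1) + scale (\<theta> x y (v 5)) (v 2) + scale (\<theta> x y (v 6)) (v 3)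
    - scale (\<theta> x y (v 1)) (v 4) - scale (\<theta> x y (v 2)) (v 5) - scale (\<theta> x y (v 3)) (v 6)" for x y
  have J: "\<Omega> (J x y) z = \<theta> x y z" for x y z
    using lin_expand[OF form_lin(3)[OF \<theta>], of x y z, unfolded Icc16]
    by (simp add: J_def Omega_explicit algebra_simps)
  have "alternating_bilinear scale scale J"
    unfolding alternating_bilinear_def linear_iff_add_scale
    by (auto intro!: Omega_nondegenerate simp: J form_add[OF \<theta>] form_scale[OF \<theta>] form_zero[OF \<theta>])
  moreover have "J' = J" if "\<forall>x y z. \<theta> x y z = \<Omega> (J' x y) z" for J'
    using that by (intro ext Omega_nondegenerate) (simp add: J)
  ultimately have "Jmap scale \<Omega> \<theta> = J"
    unfolding Jmap_def using J by (intro the_equality) auto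
  with J \<open>alternating_bilinear scale scale J\<close>
  show "alternating_bilinear scale scale (Jmap scale \<Omega> \<theta>)" "\<Omega> (Jmap scale \<Omega> \<theta> x y) z = \<theta> x y z"
    by auto
qed

lemma co_Jmap:
  assumes "\<theta> \<in> X"
  shows "co 1 (Jmap scale \<Omega> \<theta> x y) = \<theta> x y (v 4)" "co 2 (Jmap scale \<Omega> \<theta> x y) = \<theta> x y (v 5)"
    "co 3 (Jmap scale \<Omega> \<theta> x y) = \<theta> x y (v 6)" "co 4 (Jmap scale \<Omega> \<theta> x y) = - \<theta> x y (v 1)"
    "co 5 (Jmap scale \<Omega> \<theta> x y) = - \<theta> x y (v 2)" "co 6 (Jmap scale \<Omega> \<theta> x y) = - \<theta> x y (v 3)"
  using Omega_Jmap[OF assms, of x y] Omega_basis_right[of "Jmap scale \<Omega> \<theta> x y"] by simp_all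


section \<open>\<open>I\<^sub>1\<close> and \<open>I\<^sub>2\<close> are invariant polynomials\<close>

text \<open>Polynomial functions are extensional; this predicate permits ordinary functions, so
  closure rules apply to formulas without nested restrictions.\<close>

definition polyn :: "(('v \<Rightarrow> 'v \<Rightarrow> 'v \<Rightarrow> 'f) \<Rightarrow> 'f) \<Rightarrow> bool"
  where "polyn F \<longleftrightarrow> restrict F X \<in> polynomial_functions scale"

lemma polyn_cong: "(\<And>\<theta>. \<theta> \<in> X \<Longrightarrow> F \<theta> = G \<theta>) \<Longrightarrow> polyn F \<longleftrightarrow> polyn G"
  by (simp add: polyn_def cong: restrict_cong)

lemma polyn_const: "polyn (\<lambda>\<theta>. c)"
  by (simp add: polyn_def poly_const)

lemma polyn_add: "polyn F \<Longrightarrow> polyn G \<Longrightarrow> polyn (\<lambda>\<theta>. F \<theta> + G \<theta>)"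
  unfolding polyn_def by (drule (1) poly_add) (simp cong: restrict_cong)

lemma polyn_mult: "polyn F \<Longrightarrow> polyn G \<Longrightarrow> polyn (\<lambda>\<theta>. F \<theta> * G \<theta>)"
  unfolding polyn_def by (drule (1) poly_mult) (simp cong: restrict_cong)

lemma polyn_uminus: "polyn F \<Longrightarrow> polyn (\<lambda>\<theta>. - F \<theta>)"
  using polyn_mult[OF polyn_const[of "- 1"]] by simp

lemma polyn_divide: "polyn F \<Longrightarrow> polyn (\<lambda>\<theta>. F \<theta> / c)"
  using polyn_mult[OF polyn_const[of "1 / c"]] by simp

lemma polyn_sum: "(\<And>i. i \<in> S \<Longrightarrow> polyn (F i)) \<Longrightarrow> polyn (\<lambda>\<theta>. \<Sum>i\<in>S. F i \<theta>)"
  by (induction S rule: infinite_finite_induct) (auto intro: polyn_add polyn_const)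

lemma polyn_eval: "polyn (\<lambda>\<theta>. \<theta> x y z)"
  unfolding polyn_def polynomial_functions_def
  by (rule generated_algebra.gen) (simp add: linear_functionals_def)

lemma Icc16_cases:
  assumes "i \<in> {1..6::nat}"
  obtains "i = 1" | "i = 2" | "i = 3" | "i = 4" | "i = 5" | "i = 6"
  using assms unfolding Icc16 by blast

lemma polyn_co_vtheta:
  assumes "i \<in> {1..6}"
  shows "polyn (\<lambda>\<theta>. co i (vtheta \<Omega> \<theta>))"
proof -
  have "polyn (\<lambda>\<theta>. contraction \<theta> x / 6)" "polyn (\<lambda>\<theta>. - contraction \<theta> x / 6)" for x
    unfolding contraction_def by (intro polyn_divide polyn_add polyn_eval polyn_uminus)+
  then show ?thesis
    by - (rule Icc16_cases[OF assms], simp_all only: co_vtheta cong: polyn_cong)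
qed

lemma polyn_co_Jmap:
  assumes "i \<in> {1..6}"
  shows "polyn (\<lambda>\<theta>. co i (Jmap scale \<Omega> \<theta> x y))"
  by (rule Icc16_cases[OF assms])
    (simp_all only: co_Jmap polyn_eval polyn_uminus cong: polyn_cong)

lemma Jmap_add:
  assumes "\<theta> \<in> X"
  shows "Jmap scale \<Omega> \<theta> (x + x') y = Jmap scale \<Omega> \<theta> x y + Jmap scale \<Omega> \<theta> x' y"
    and "Jmap scale \<Omega> \<theta> x (y + y') = Jmap scale \<Omega> \<theta> x y + Jmap scale \<Omega> \<theta> x y'"
    and "Jmap scale \<Omega> \<theta> (scale c x) y = scale c (Jmap scale \<Omega> \<theta> x y)"
    and "Jmap scale \<Omega> \<theta> x (scale c y) = scale c (Jmap scale \<Omega> \<theta> x y)"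
  using Jmap_bilinear[OF assms] by (auto simp: alternating_bilinear_def linear_iff_add_scale)

text \<open>Both the nested map in \<open>xi\<close> and \<open>vtheta\<close> in
  \<open>Lmap\<close> occupy the first slot of \<open>Jmap\<close>. Expanding that slot gives sums
  of products of functions already known to be polynomial in \<theta>.\<close>

lemma co_Jmap_expand:
  assumes "\<theta> \<in> X"
  shows "co i (Jmap scale \<Omega> \<theta> x y) = (\<Sum>m = 1..6. co m x * co i (Jmap scale \<Omega> \<theta> (v m) y))"
  by (rule lin_expand) (simp add: lin_def Jmap_add[OF assms])

lemma polyn_xi:
  assumes "l \<in> {1..6}"
  shows "polyn (\<lambda>\<theta>. xi scale \<Omega> v \<theta> i j k l)"
proof -
  have J: "polyn (\<lambda>\<theta>. co l (Jmap scale \<Omega> \<theta> (Jmap scale \<Omega> \<theta> (v i) (v j)) (v k)))" for i j k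
  proof -
    have "polyn (\<lambda>\<theta>. \<Sum>m = 1..6. co m (Jmap scale \<Omega> \<theta> (v i) (v j)) * co l (Jmap scale \<Omega> \<theta> (v m) (v k)))"
      using assms by (intro polyn_sum polyn_mult polyn_co_Jmap)
    then show ?thesis
      by (rule polyn_cong[THEN iffD2, rotated]) (rule co_Jmap_expand)
  qed
  show ?thesis
    unfolding xi_def barwedge_def co_add by (intro polyn_add J)
qed

lemma polyn_I2: "polyn (I2 scale \<Omega> v)"
  unfolding I2_def[abs_def] mult.assoc
  by (intro polyn_mult[OF polyn_const] polyn_sum polyn_mult[OF polyn_const] polyn_mult polyn_xi) auto

definition ppolyn :: "(('v \<Rightarrow> 'v \<Rightarrow> 'v \<Rightarrow> 'f) \<Rightarrow> 'f poly) \<Rightarrow> bool"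
  where "ppolyn P \<longleftrightarrow> (\<forall>k. polyn (\<lambda>\<theta>. coeff (P \<theta>) k))"

lemma ppolyn_const: "ppolyn (\<lambda>\<theta>. p)"
  by (simp add: ppolyn_def polyn_const)

lemma ppolyn_add: "ppolyn P \<Longrightarrow> ppolyn Q \<Longrightarrow> ppolyn (\<lambda>\<theta>. P \<theta> + Q \<theta>)"
  by (simp add: ppolyn_def polyn_add)

lemma ppolyn_mult: "ppolyn P \<Longrightarrow> ppolyn Q \<Longrightarrow> ppolyn (\<lambda>\<theta>. P \<theta> * Q \<theta>)"
  unfolding ppolyn_def coeff_mult by (intro allI polyn_sum polyn_mult) auto

lemma ppolyn_sum: "(\<And>i. i \<in> S \<Longrightarrow> ppolyn (P i)) \<Longrightarrow> ppolyn (\<lambda>\<theta>. \<Sum>i\<in>S. P i \<theta>)"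
  by (induction S rule: infinite_finite_induct) (auto intro: ppolyn_add ppolyn_const)

lemma ppolyn_prod: "(\<And>i. i \<in> S \<Longrightarrow> ppolyn (P i)) \<Longrightarrow> ppolyn (\<lambda>\<theta>. \<Prod>i\<in>S. P i \<theta>)"
  by (induction S rule: infinite_finite_induct) (auto intro: ppolyn_mult ppolyn_const)

lemma ppolyn_char_poly:
  assumes "\<And>i j. i < n \<Longrightarrow> j < n \<Longrightarrow> polyn (\<lambda>\<theta>. M \<theta> i j)"
  shows "ppolyn (\<lambda>\<theta>. char_poly (mat n n (\<lambda>(i, j). M \<theta> i j)))"
proof -
  have less: "p i < n" if "p permutes {0..<n}" "i < n" for p i
    using permutes_in_image[OF that(1), of i] that(2) by simp
  have M: "char_poly (mat n n (\<lambda>(i, j). M \<theta> i j)) = (\<Sum>p | p permutes {0..<n}. signof p *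
      (\<Prod>i = 0..<n. (if i = p i then [:0, 1:] else 0) + [:- M \<theta> i (p i):]))" for \<theta>
    unfolding char_poly_def char_poly_matrix_def
    by (subst det_def') (auto intro!: sum.cong prod.cong arg_cong2[where f = "(*)"] simp: less)
  have "ppolyn (\<lambda>\<theta>. [:- M \<theta> i j:])" if "i < n" "j < n" for i j
    unfolding ppolyn_def
  proof
    show "polyn (\<lambda>\<theta>. coeff [:- M \<theta> i j:] k)" for k
      using polyn_uminus[OF assms[OF that]] by (cases k) (simp_all add: polyn_const)
  qed
  then show ?thesis
    unfolding M by (intro ppolyn_sum ppolyn_mult ppolyn_prod ppolyn_const ppolyn_add) (auto simp: less)
qed

lemma polyn_I1: "polyn (I1 scale \<Omega> v)"
proof -
  have "polyn (\<lambda>\<theta>. co (Suc i) (Lmap scale \<Omega> \<theta> (v (Suc j))))" if "i < 6" for i j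
  proof -
    have "polyn (\<lambda>\<theta>. \<Sum>m = 1..6. co m (vtheta \<Omega> \<theta>) * co (Suc i) (Jmap scale \<Omega> \<theta> (v m) (v (Suc j))))"
      using that by (intro polyn_sum polyn_mult polyn_co_Jmap polyn_co_vtheta) auto
    then show ?thesis
      unfolding Lmap_def by (rule polyn_cong[THEN iffD2, rotated]) (rule co_Jmap_expand)
  qed
  from ppolyn_char_poly[of 6, OF this]
  show ?thesis
    unfolding I1_def[abs_def] endo_matrix_def ppolyn_def
    by (intro polyn_mult[OF polyn_const]) auto
qed


section \<open>Equivariance under the symplectic group\<close>

lemma Jmap_act:
  assumes A: "A \<in> Sp scale \<Omega>" and \<theta>: "\<theta> \<in> X"
  shows "Jmap scale \<Omega> (act A \<theta>) x y = A (Jmap scale \<Omega> \<theta> (inv_into UNIV A x) (inv_into UNIV A y))"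
proof (rule Omega_nondegenerate)
  fix z
  have "\<Omega> (A (Jmap scale \<Omega> \<theta> (inv_into UNIV A x) (inv_into UNIV A y))) z =
      \<Omega> (A (Jmap scale \<Omega> \<theta> (inv_into UNIV A x) (inv_into UNIV A y))) (A (inv_into UNIV A z))"
    by (simp only: SpD(6)[OF A])
  also have "\<dots> = act A \<theta> x y z"
    by (simp only: SpD(4)[OF A] Omega_Jmap[OF \<theta>] act_def)
  finally show "\<Omega> (Jmap scale \<Omega> (act A \<theta>) x y) z =
      \<Omega> (A (Jmap scale \<Omega> \<theta> (inv_into UNIV A x) (inv_into UNIV A y))) z"
    by (simp only: Omega_Jmap[OF act_form[OF A \<theta>]])
qed

lemma vol_Sp: "A \<in> Sp scale \<Omega> \<Longrightarrow> vol (\<lambda>i. A (x i)) = vol x"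
  by (simp add: vol_eq SpD(4))

lemma vtheta_act:
  assumes A: "A \<in> Sp scale \<Omega>" and \<theta>: "\<theta> \<in> X"
  shows "vtheta \<Omega> (act A \<theta>) = A (vtheta \<Omega> \<theta>)"
proof -
  let ?u = "vtheta \<Omega> \<theta>" and ?B = "inv_into UNIV A"
  have u: "insertion ?u vol = wedge 3 2 (form3 \<theta>) (form2 \<Omega>)"
    using vtheta_iff[OF \<theta>] by blast
  have B: "\<Omega> (?B x) (?B y) = \<Omega> x y" for x y
    using SpD(4)[OF Sp_inv[OF A]] .
  have "insertion (A ?u) vol x = wedge 3 2 (form3 (act A \<theta>)) (form2 \<Omega>) x" for x
  proof -
    have "case_nat (A ?u) x = (\<lambda>i. A (case_nat ?u (\<lambda>i. ?B (x i)) i))"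
      by (auto simp: fun_eq_iff SpD(6)[OF A] split: nat.split)
    then have "insertion (A ?u) vol x = vol (case_nat ?u (\<lambda>i. ?B (x i)))"
      unfolding insertion_def by (simp only: vol_Sp[OF A])
    also have "\<dots> = wedge 3 2 (form3 \<theta>) (form2 \<Omega>) (\<lambda>i. ?B (x i))"
      using u by (simp only: insertion_def fun_eq_iff)
    also have "\<dots> = wedge 3 2 (form3 (act A \<theta>)) (form2 \<Omega>) x"
      unfolding wedge_form_Omega[OF \<theta>] wedge_form_Omega[OF act_form[OF A \<theta>]] act_def B ..
    finally show ?thesis .
  qed
  then show ?thesis
    using vtheta_iff[OF act_form[OF A \<theta>], of "A ?u"] by (simp add: fun_eq_iff)
qed

abbreviation endo :: "('v \<Rightarrow> 'v) \<Rightarrow> 'f mat" where "endo \<equiv> endo_matrix scale v"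

lemma endo_comp:
  assumes "\<And>x y. f (x + y) = f x + f y" "\<And>c x. f (scale c x) = scale c (f x)"
  shows "endo (\<lambda>x. f (g x)) = endo f * endo g"
proof (rule eq_matI)
  fix i j assume "i < dim_row (endo f * endo g)" "j < dim_col (endo f * endo g)"
  then have ij: "i < 6" "j < 6" by (auto simp: endo_matrix_def)
  have "lin scale (\<lambda>w. co (Suc i) (f w))" by (simp add: lin_def assms)
  from lin_expand[OF this, of "g (v (Suc j))"] ij
  show "endo (\<lambda>x. f (g x)) $$ (i, j) = (endo f * endo g) $$ (i, j)"
    by (simp add: endo_matrix_def scalar_prod_def sum.atLeast1_atMost_eq lessThan_atLeast0 mult.commute)
qed (auto simp: endo_matrix_def)

lemma endo_id: "endo (\<lambda>x. x) = 1\<^sub>m 6"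
  by (rule eq_matI) (auto simp: endo_matrix_def co_basis)

text \<open>Equivariance of \<open>vtheta\<close> and \<open>Jmap\<close> conjugates
  \<open>Lmap\<close> by \<open>A\<close>, so the two matrices are similar and share their
  characteristic polynomial.\<close>

lemma I1_act:
  assumes A: "A \<in> Sp scale \<Omega>" and \<theta>: "\<theta> \<in> X"
  shows "I1 scale \<Omega> v (act A \<theta>) = I1 scale \<Omega> v \<theta>"
proof -
  let ?B = "inv_into UNIV A" and ?L = "Lmap scale \<Omega> \<theta>"
  have L: "Lmap scale \<Omega> (act A \<theta>) = (\<lambda>y. A (?L (?B y)))"
    by (simp add: fun_eq_iff Lmap_def vtheta_act[OF A \<theta>] Jmap_act[OF A \<theta>] SpD(5)[OF A])
  have "endo (Lmap scale \<Omega> (act A \<theta>)) = endo A * endo (\<lambda>y. ?L (?B y))"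
    unfolding L by (intro endo_comp SpD(1,2)[OF A])
  also have "endo (\<lambda>y. ?L (?B y)) = endo ?L * endo ?B"
    unfolding Lmap_def by (intro endo_comp) (simp_all add: Jmap_add[OF \<theta>])
  finally have eq: "endo (Lmap scale \<Omega> (act A \<theta>)) = endo A * endo ?L * endo ?B"
    by (simp add: assoc_mult_mat[of _ 6 6 _ 6 _ 6] endo_matrix_def)
  have "endo A * endo ?B = 1\<^sub>m 6"
    using endo_comp[OF SpD(1,2)[OF A], of ?B] by (simp add: SpD(6)[OF A] endo_id)
  moreover have "endo ?B * endo A = 1\<^sub>m 6"
    using endo_comp[OF SpD(1,2)[OF Sp_inv[OF A]], of A] by (simp add: SpD(5)[OF A] endo_id)
  moreover have "endo f \<in> carrier_mat 6 6" for f
    by (simp add: endo_matrix_def)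
  ultimately have "similar_mat (endo (Lmap scale \<Omega> (act A \<theta>))) (endo ?L)"
    unfolding similar_mat_def using eq by (blast intro: similar_mat_witI)
  then show ?thesis
    by (simp add: I1_def char_poly_similar)
qed

abbreviation Xi :: "('v \<Rightarrow> 'v \<Rightarrow> 'v \<Rightarrow> 'f) \<Rightarrow> 'v \<Rightarrow> 'v \<Rightarrow> 'v \<Rightarrow> 'v"
  where "Xi \<theta> \<equiv> barwedge (Jmap scale \<Omega> \<theta>)"

lemma Xi_add:
  assumes "\<theta> \<in> X"
  shows "Xi \<theta> (x + x') y z = Xi \<theta> x y z + Xi \<theta> x' y z" "Xi \<theta> x (y + y') z = Xi \<theta> x y z + Xi \<theta> x y' z"
    "Xi \<theta> x y (z + z') = Xi \<theta> x y z + Xi \<theta> x y z'" "Xi \<theta> (scale c x) y z = scale c (Xi \<theta> x y z)"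
    "Xi \<theta> x (scale c y) z = scale c (Xi \<theta> x y z)" "Xi \<theta> x y (scale c z) = scale c (Xi \<theta> x y z)"
  by (simp_all add: barwedge_def Jmap_add[OF assms] scale_right_distrib)

lemma Xi_act:
  assumes A: "A \<in> Sp scale \<Omega>" and \<theta>: "\<theta> \<in> X"
  shows "Xi (act A \<theta>) x y z = A (Xi \<theta> (inv_into UNIV A x) (inv_into UNIV A y) (inv_into UNIV A z))"
  by (simp add: barwedge_def Jmap_act[OF A \<theta>] SpD(1,5)[OF A])

definition Xi_pairing :: "('v \<Rightarrow> 'v \<Rightarrow> 'v \<Rightarrow> 'f) \<Rightarrow> (nat \<Rightarrow> 'v) \<Rightarrow> 'f"
  where "Xi_pairing \<theta> x = \<Omega> (Xi \<theta> (x 1) (x 2) (x 3)) (Xi \<theta> (x 4) (x 5) (x 6))"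

lemma Xi_pairing_multilinear:
  assumes "\<theta> \<in> X"
  shows "multilinear {1..6} (Xi_pairing \<theta>)"
proof (rule multilinearI)
  show "lin scale (\<lambda>y. Xi_pairing \<theta> (x(i := y)))" if "i \<in> {1..6}" for i x
    by (rule Icc16_cases[OF that]) (simp_all add: Xi_pairing_def lin_def Xi_add[OF assms])
  show "Xi_pairing \<theta> x = Xi_pairing \<theta> x'" if "\<And>i. i \<in> {1..6} \<Longrightarrow> x i = x' i" for x x'
    by (simp add: Xi_pairing_def that)
qed

text \<open>Exchanging the blocks 1, 2, 3 and 4, 5, 6 takes three transpositions, hence is odd, and
  \<Omega> changes sign between its two halves. So both halves contribute equally to the
  alternation. \<open>I2\<close> records one of them, which turns 1/3 into 1/6.\<close>

lemma I2_eq_alternation: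
  "I2 scale \<Omega> v \<theta> = - (1 / 6) * alternation {1..6} (Xi_pairing \<theta>) v"
proof -
  let ?a = "\<lambda>l \<sigma>. xi scale \<Omega> v \<theta> (\<sigma> 1) (\<sigma> 2) (\<sigma> 3) l"
  let ?b = "\<lambda>l \<sigma>. xi scale \<Omega> v \<theta> (\<sigma> 4) (\<sigma> 5) (\<sigma> 6) l"
  let ?P = "{\<sigma>. \<sigma> permutes {1..6::nat}}"
  let ?\<rho> = "transpose 1 4 \<circ> (transpose 2 5 \<circ> transpose 3 (6::nat))"
  have \<rho>: "?\<rho> permutes {1..6}"
    by (intro permutes_compose permutes_swap_id) auto
  have sgn: "sign (\<sigma> \<circ> ?\<rho>) = - sign \<sigma>" if "\<sigma> permutes {1..6}" for \<sigma>
  proof -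
    have "permutation \<sigma>" using that by (auto simp: permutation_permutes)
    then show ?thesis
      by (simp add: sign_compose permutation_swap_id permutation_compose sign_swap_id)
  qed
  have swap: "(\<Sum>\<sigma>\<in>?P. of_int (sign \<sigma>) * (?a (l + 3) \<sigma> * ?b l \<sigma>)) =
      - (\<Sum>\<sigma>\<in>?P. of_int (sign \<sigma>) * (?a l \<sigma> * ?b (l + 3) \<sigma>))" for l
  proof (subst sum_permutations_compose_right[OF \<rho>], unfold sum_negf[symmetric], intro sum.cong refl)
    fix \<sigma> assume "\<sigma> \<in> ?P"
    then have "of_int (sign (\<sigma> \<circ> ?\<rho>)) = (- of_int (sign \<sigma>) :: 'f)"
      by (simp only: mem_Collect_eq sgn of_int_minus)
    moreover have "(\<sigma> \<circ> ?\<rho>) 1 = \<sigma> 4" "(\<sigma> \<circ> ?\<rho>) 2 = \<sigma> 5" "(\<sigma> \<circ> ?\<rho>) 3 = \<sigma> 6"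
      "(\<sigma> \<circ> ?\<rho>) 4 = \<sigma> 1" "(\<sigma> \<circ> ?\<rho>) 5 = \<sigma> 2" "(\<sigma> \<circ> ?\<rho>) 6 = \<sigma> 3"
      by (simp_all add: transpose_def)
    ultimately show "of_int (sign (\<sigma> \<circ> ?\<rho>)) * (?a (l + 3) (\<sigma> \<circ> ?\<rho>) * ?b l (\<sigma> \<circ> ?\<rho>)) =
        - (of_int (sign \<sigma>) * (?a l \<sigma> * ?b (l + 3) \<sigma>))"
      by (simp only: mult.commute mult_minus_left mult_minus_right)
  qed
  have "Xi_pairing \<theta> (v \<circ> \<sigma>) = (\<Sum>l = 1..3. ?a l \<sigma> * ?b (l + 3) \<sigma> - ?b l \<sigma> * ?a (l + 3) \<sigma>)" for \<sigma>
    by (simp only: Xi_pairing_def Omega_co xi_def o_def)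
  then have "alternation {1..6} (Xi_pairing \<theta>) v =
      (\<Sum>\<sigma>\<in>?P. \<Sum>l = 1..3. of_int (sign \<sigma>) * (?a l \<sigma> * ?b (l + 3) \<sigma>) - of_int (sign \<sigma>) * (?a (l + 3) \<sigma> * ?b l \<sigma>))"
    by (simp only: alternation_def sum_distrib_left right_diff_distrib mult.commute[of "?b _ _"])
  also have "\<dots> = (\<Sum>l = 1..3. (\<Sum>\<sigma>\<in>?P. of_int (sign \<sigma>) * (?a l \<sigma> * ?b (l + 3) \<sigma>)) -
      (\<Sum>\<sigma>\<in>?P. of_int (sign \<sigma>) * (?a (l + 3) \<sigma> * ?b l \<sigma>)))"
    by (subst sum.swap) (simp only: sum_subtractf)
  also have "\<dots> = 2 * (\<Sum>l = 1..3. \<Sum>\<sigma>\<in>?P. of_int (sign \<sigma>) * (?a l \<sigma> * ?b (l + 3) \<sigma>))"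
    by (simp only: swap diff_minus_eq_add mult_2 sum.distrib)
  finally show ?thesis
    by (simp add: I2_def mult.assoc)
qed

text \<open>The volume form with slots numbered from 1, to match \<open>Xi_pairing\<close>.\<close>

definition vol6 :: "(nat \<Rightarrow> 'v) \<Rightarrow> 'f"
  where "vol6 x = vol (\<lambda>i. x (Suc i))"

lemma vol6_alternating: "alternating {1..6} vol6"
proof (intro alternatingI multilinearI)
  note m = alternating_multilinear[OF vol_alternating]
  show "lin scale (\<lambda>y. vol6 (x(i := y)))" if "i \<in> {1..6}" for i x
  proof -
    have "(\<lambda>k. (x(i := y)) (Suc k)) = (\<lambda>k. x (Suc k))(i - 1 := y)" for y
      using that by (auto simp: fun_eq_iff)
    moreover have "i - 1 \<in> {..<6}" using that by auto
    ultimately show ?thesis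
      unfolding vol6_def using multilinear_lin[OF m] by simp
  qed
  show "vol6 x = vol6 x'" if "\<And>i. i \<in> {1..6} \<Longrightarrow> x i = x' i" for x x'
    unfolding vol6_def by (rule multilinear_cong[OF m]) (use that in auto)
  show "vol6 x = 0" if "i \<in> {1..6}" "j \<in> {1..6}" "i \<noteq> j" "x i = x j" for x i j
    unfolding vol6_def
    by (rule alternating_zero[OF vol_alternating, of "i - 1" "j - 1"]) (use that in auto)
qed

lemma vol6_basis: "vol6 v = - 6"
  by (simp add: vol6_def vol_eq Omega_basis_left[unfolded One_nat_def] numeral_2_eq_2[symmetric])

lemma alternating6_eq_vol6:
  assumes h: "alternating {1..6} h"
  shows "h x = h v / vol6 v * vol6 x"
proof -
  have "h x + (- (h v / vol6 v)) * vol6 x = 0"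
    by (rule alternating6_eq_0I[OF alternating_add[OF h alternating_times[OF vol6_alternating]]])
      (simp add: vol6_basis)
  then show ?thesis by simp
qed

lemma I2_act:
  assumes A: "A \<in> Sp scale \<Omega>" and \<theta>: "\<theta> \<in> X"
  shows "I2 scale \<Omega> v (act A \<theta>) = I2 scale \<Omega> v \<theta>"
proof -
  let ?B = "inv_into UNIV A" and ?G = "alternation {1..6} (Xi_pairing \<theta>)"
  \<comment> \<open>The outer \<open>A\<close> from \<open>Xi_act\<close> disappears under \<Omega>,
    so only the arguments of the 6-form are moved.\<close>
  have "alternation {1..6} (Xi_pairing (act A \<theta>)) v = ?G (\<lambda>i. ?B (v i))"
    by (simp add: alternation_def Xi_pairing_def Xi_act[OF A \<theta>] SpD(4)[OF A])
  also have "\<dots> = ?G v / vol6 v * vol6 (\<lambda>i. ?B (v i))"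
    by (intro alternating6_eq_vol6 alternation_alternating Xi_pairing_multilinear \<theta>) simp
  also have "vol6 (\<lambda>i. ?B (v i)) = vol6 v"
    unfolding vol6_def by (rule vol_Sp[OF Sp_inv[OF A]])
  finally show ?thesis
    by (simp add: I2_eq_alternation vol6_basis)
qed

end

section \<open>Values of the invariants on the section\<close>

text \<open>Grouping permutations by the image of the first three positions leaves 20 signed
  splittings, each counted 3! 3! = 36 times by antisymmetry.\<close>

lemma laplace_3_3:
  fixes a b :: "nat \<Rightarrow> nat \<Rightarrow> nat \<Rightarrow> 'a::comm_ring_1"
  assumes a: "\<And>i j k. a j i k = - a i j k" "\<And>i j k. a i k j = - a i j k"
    and b: "\<And>i j k. b j i k = - b i j k" "\<And>i j k. b i k j = - b i j k"
  shows "(\<Sum>\<sigma> | \<sigma> permutes {1..6}. of_int (sign \<sigma>) * (a (\<sigma> 1) (\<sigma> 2) (\<sigma> 3) * b (\<sigma> 4) (\<sigma> 5) (\<sigma> 6))) =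
    36 * (a 1 2 3 * b 4 5 6 - a 1 2 4 * b 3 5 6 + a 1 2 5 * b 3 4 6 - a 1 2 6 * b 3 4 5
      + a 1 3 4 * b 2 5 6 - a 1 3 5 * b 2 4 6 + a 1 3 6 * b 2 4 5 + a 1 4 5 * b 2 3 6
      - a 1 4 6 * b 2 3 5 + a 1 5 6 * b 2 3 4 - a 2 3 4 * b 1 5 6 + a 2 3 5 * b 1 4 6
      - a 2 3 6 * b 1 4 5 - a 2 4 5 * b 1 3 6 + a 2 4 6 * b 1 3 5 - a 2 5 6 * b 1 3 4
      + a 3 4 5 * b 1 2 6 - a 3 4 6 * b 1 2 5 + a 3 5 6 * b 1 2 4 - a 4 5 6 * b 1 2 3)"
proof -
  let ?h = "\<lambda>l. b (l ! 0) (l ! 1) (l ! 2)"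
  have as: "i < j \<Longrightarrow> a j i k = - a i j k" "j < k \<Longrightarrow> a i k j = - a i j k"
    and bs: "i < j \<Longrightarrow> b j i k = - b i j k" "j < k \<Longrightarrow> b i k j = - b i j k" for i j k
    by (rule a, rule a, rule b, rule b)
  define F where "F = (\<lambda>l. a (l ! 0) (l ! 1) (l ! 2) * ?h (drop 3 l))"
  have F: "alt_prefix [p, q, r] [i, j, k] F = a p q r * (6 * b i j k)" if "distinct [i, j, k]" for p q r i j k
  proof -
    have b': "b i k j = - b i j k" "b j i k = - b i j k" "b k i j = - b i k j" "b j k i = - b j i k"
      "b k j i = - b k i j"
      by (rule b)+
    have "alt_prefix [p, q, r] [i, j, k] F = a p q r * alt_prefix [] [i, j, k] ?h"
      unfolding F_def alt_prefix_def by (simp add: alt_sum_times numeral_2_eq_2 numeral_3_eq_3)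
    moreover have ne: "i \<noteq> j" "i \<noteq> k" "j \<noteq> k"
      using that by auto
    ultimately show ?thesis
      using ne[symmetric] by (simp add: alt_eval transpose_def b' cong: alt_prefix_cong alt_step_cong)
  qed
  have set: "{1..6::nat} = set [1, 2, 3, 4, 5, 6]"
    by auto
  have "(\<Sum>\<sigma> | \<sigma> permutes {1..6}. of_int (sign \<sigma>) * (a (\<sigma> 1) (\<sigma> 2) (\<sigma> 3) * b (\<sigma> 4) (\<sigma> 5) (\<sigma> 6))) =
      (\<Sum>\<sigma> | \<sigma> permutes set [1, 2, 3, 4, 5, 6]. of_int (sign \<sigma>) * F (map \<sigma> [1, 2, 3, 4, 5, 6]))"
    unfolding set F_def by (intro sum.cong refl) (simp add: numeral_2_eq_2 numeral_3_eq_3)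
  also have "\<dots> = alt_prefix [] [1, 2, 3, 4, 5, 6] F"
    unfolding alt_sum_prefix[symmetric] by (rule sum_permutes_eq_alt_sum) simp
  also have "\<dots> = 36 * (a 1 2 3 * b 4 5 6 - a 1 2 4 * b 3 5 6 + a 1 2 5 * b 3 4 6 - a 1 2 6 * b 3 4 5
      + a 1 3 4 * b 2 5 6 - a 1 3 5 * b 2 4 6 + a 1 3 6 * b 2 4 5 + a 1 4 5 * b 2 3 6
      - a 1 4 6 * b 2 3 5 + a 1 5 6 * b 2 3 4 - a 2 3 4 * b 1 5 6 + a 2 3 5 * b 1 4 6
      - a 2 3 6 * b 1 4 5 - a 2 4 5 * b 1 3 6 + a 2 4 6 * b 1 3 5 - a 2 5 6 * b 1 3 4
      + a 3 4 5 * b 1 2 6 - a 3 4 6 * b 1 2 5 + a 3 5 6 * b 1 2 4 - a 4 5 6 * b 1 2 3)"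
    by (simp add: alt_eval(2)[of "[]"] alt_eval(2)[of "[p]" for p] alt_eval(2)[of "[p, q]" for p q] alt_eval(3,4)
        F transpose_def as bs cong: alt_prefix_cong alt_step_cong)
  finally show ?thesis .
qed

section \<open>Sparse determinants\<close>

fun row_prod :: "(nat \<Rightarrow> 'a::comm_ring_1) list \<Rightarrow> nat list \<Rightarrow> 'a"
  where "row_prod [] l = 1"
  | "row_prod (g # gs) l = g (hd l) * row_prod gs (tl l)"

text \<open>The Leibniz sum arranged for row expansion: \<open>gs\<close> holds the rows still to be
  expanded and \<open>xs\<close> the columns still free. Signs come from transpositions instead of
  column positions.\<close>

definition det_rows :: "(nat \<Rightarrow> 'a::comm_ring_1) list \<Rightarrow> nat list \<Rightarrow> 'a"
  where "det_rows gs xs = alt_sum xs (row_prod gs)"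

definition det_step :: "(nat \<Rightarrow> 'a::comm_ring_1) \<Rightarrow> (nat \<Rightarrow> 'a) list \<Rightarrow> nat \<Rightarrow> nat list \<Rightarrow> nat list \<Rightarrow> 'a"
  where "det_step g gs a xs bs =
    (\<Sum>b\<leftarrow>bs. (if b = a then 1 else - 1) * (g b * det_rows gs (map (transpose a b) xs)))"

text \<open>The test \<open>g b = 0\<close> prunes the expansion of sparse determinants.\<close>

lemma det_eval:
  "det_rows [] [] = 1"
  "det_rows (g # gs) (a # xs) = det_step g gs a xs (a # xs)"
  "det_step g gs a xs [] = 0"
  "det_step g gs a xs (b # bs) =
    (if g b = 0 then 0 else if b = a then g b * det_rows gs xs
     else - (g b * det_rows gs (map (transpose a b) xs))) + det_step g gs a xs bs"
  by (simp_all add: det_step_def det_rows_def alt_sum.simps alt_sum_map alt_sum_times)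

lemma det_rows_cong: "xs = ys \<Longrightarrow> det_rows gs xs = det_rows gs ys"
  and det_step_cong: "a = b \<Longrightarrow> xs = ys \<Longrightarrow> bs = cs \<Longrightarrow> det_step g gs a xs bs = det_step g gs b ys cs"
  by auto

lemma det6:
  assumes A: "A \<in> carrier_mat 6 6"
  shows "det A = det_rows [\<lambda>j. A $$ (0, j), \<lambda>j. A $$ (1, j), \<lambda>j. A $$ (2, j), \<lambda>j. A $$ (3, j),
    \<lambda>j. A $$ (4, j), \<lambda>j. A $$ (5, j)] [0, 1, 2, 3, 4, 5]"
proof -
  let ?gs = "[\<lambda>j. A $$ (0, j), \<lambda>j. A $$ (1, j), \<lambda>j. A $$ (2, j), \<lambda>j. A $$ (3, j),
    \<lambda>j. A $$ (4, j), \<lambda>j. A $$ (5, j)]"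
  have set: "{0..<6::nat} = set [0, 1, 2, 3, 4, 5]" by auto
  have "det A = (\<Sum>p | p permutes set [0, 1, 2, 3, 4, 5]. of_int (sign p) * row_prod ?gs (map p [0, 1, 2, 3, 4, 5]))"
    unfolding det_def'[OF A] set by (intro sum.cong refl) (simp add: mult_ac)
  also have "\<dots> = det_rows ?gs [0, 1, 2, 3, 4, 5]"
    unfolding det_rows_def by (rule sum_permutes_eq_alt_sum) simp
  finally show ?thesis .
qed

context symplectic_space
begin

lemma Jmap_swap:
  assumes "\<theta> \<in> X"
  shows "Jmap scale \<Omega> \<theta> y x = - Jmap scale \<Omega> \<theta> x y"
proof (rule Omega_nondegenerate)
  fix z
  have "\<Omega> (- w) z = - \<Omega> w z" for w
    using Omega_scale_left[of "- 1" w z] by simp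
  then show "\<Omega> (Jmap scale \<Omega> \<theta> y x) z = \<Omega> (- Jmap scale \<Omega> \<theta> x y) z"
    by (simp add: Omega_Jmap[OF assms] form_swap12[OF assms, of y x])
qed

lemma xi_swap:
  assumes "\<theta> \<in> X"
  shows "xi scale \<Omega> v \<theta> j i k l = - xi scale \<Omega> v \<theta> i j k l" "xi scale \<Omega> v \<theta> i k j l = - xi scale \<Omega> v \<theta> i j k l"
proof -
  have m: "Jmap scale \<Omega> \<theta> (- x) y = - Jmap scale \<Omega> \<theta> x y" for x y
    using Jmap_add(3)[OF assms, of "- 1" x y] by simp
  show "xi scale \<Omega> v \<theta> j i k l = - xi scale \<Omega> v \<theta> i j k l"
    by (simp add: xi_def barwedge_def Jmap_swap[OF assms, of "v j" "v i"] Jmap_swap[OF assms, of "v k" "v i"]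
        Jmap_swap[OF assms, of "v k" "v j"] m)
  show "xi scale \<Omega> v \<theta> i k j l = - xi scale \<Omega> v \<theta> i j k l"
    by (simp add: xi_def barwedge_def Jmap_swap[OF assms, of "v j" "v i"] Jmap_swap[OF assms, of "v k" "v i"]
        Jmap_swap[OF assms, of "v k" "v j"] m)
qed

definition quad :: "('v \<Rightarrow> 'v \<Rightarrow> 'v \<Rightarrow> 'f) \<Rightarrow> nat \<Rightarrow> nat \<Rightarrow> nat \<Rightarrow> nat \<Rightarrow> 'f"
  where "quad \<theta> i j k m =
    \<theta> (v i) (v j) (v 4) * \<theta> (v 1) (v k) (v m) + \<theta> (v i) (v j) (v 5) * \<theta> (v 2) (v k) (v m) +
    \<theta> (v i) (v j) (v 6) * \<theta> (v 3) (v k) (v m) - \<theta> (v i) (v j) (v 1) * \<theta> (v 4) (v k) (v m) -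
    \<theta> (v i) (v j) (v 2) * \<theta> (v 5) (v k) (v m) - \<theta> (v i) (v j) (v 3) * \<theta> (v 6) (v k) (v m)"

lemma form_Jmap:
  assumes "\<theta> \<in> X"
  shows "\<theta> (Jmap scale \<Omega> \<theta> (v i) (v j)) (v k) (v m) = quad \<theta> i j k m"
  using lin_expand[OF form_lin(1)[OF assms], of "Jmap scale \<Omega> \<theta> (v i) (v j)" "v k" "v m", unfolded Icc16]
    co_Jmap[OF assms, of "v i" "v j"]
  by (simp add: quad_def)

lemma xi_quad:
  assumes "\<theta> \<in> X"
  shows "xi scale \<Omega> v \<theta> i j k 1 = quad \<theta> i j k 4 + quad \<theta> j k i 4 + quad \<theta> k i j 4"
    "xi scale \<Omega> v \<theta> i j k 2 = quad \<theta> i j k 5 + quad \<theta> j k i 5 + quad \<theta> k i j 5"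
    "xi scale \<Omega> v \<theta> i j k 3 = quad \<theta> i j k 6 + quad \<theta> j k i 6 + quad \<theta> k i j 6"
    "xi scale \<Omega> v \<theta> i j k 4 = - (quad \<theta> i j k 1 + quad \<theta> j k i 1 + quad \<theta> k i j 1)"
    "xi scale \<Omega> v \<theta> i j k 5 = - (quad \<theta> i j k 2 + quad \<theta> j k i 2 + quad \<theta> k i j 2)"
    "xi scale \<Omega> v \<theta> i j k 6 = - (quad \<theta> i j k 3 + quad \<theta> j k i 3 + quad \<theta> k i j 3)"
  by (simp_all only: xi_def barwedge_def co_add co_Jmap[OF assms] form_Jmap[OF assms] minus_add_distrib)

lemma I2_laplace:
  assumes "\<theta> \<in> X"
  defines "x \<equiv> xi scale \<Omega> v \<theta>"
  shows "I2 scale \<Omega> v \<theta> = - 12 * (\<Sum>l\<in>{1, 2, 3}.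
      x 1 2 3 l * x 4 5 6 (l + 3) - x 1 2 4 l * x 3 5 6 (l + 3) + x 1 2 5 l * x 3 4 6 (l + 3) - x 1 2 6 l * x 3 4 5 (l + 3)
      + x 1 3 4 l * x 2 5 6 (l + 3) - x 1 3 5 l * x 2 4 6 (l + 3) + x 1 3 6 l * x 2 4 5 (l + 3) + x 1 4 5 l * x 2 3 6 (l + 3)
      - x 1 4 6 l * x 2 3 5 (l + 3) + x 1 5 6 l * x 2 3 4 (l + 3) - x 2 3 4 l * x 1 5 6 (l + 3) + x 2 3 5 l * x 1 4 6 (l + 3)
      - x 2 3 6 l * x 1 4 5 (l + 3) - x 2 4 5 l * x 1 3 6 (l + 3) + x 2 4 6 l * x 1 3 5 (l + 3) - x 2 5 6 l * x 1 3 4 (l + 3)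
      + x 3 4 5 l * x 1 2 6 (l + 3) - x 3 4 6 l * x 1 2 5 (l + 3) + x 3 5 6 l * x 1 2 4 (l + 3) - x 4 5 6 l * x 1 2 3 (l + 3))"
proof -
  let ?S = "\<lambda>l. x 1 2 3 l * x 4 5 6 (l + 3) - x 1 2 4 l * x 3 5 6 (l + 3) + x 1 2 5 l * x 3 4 6 (l + 3) - x 1 2 6 l * x 3 4 5 (l + 3)
      + x 1 3 4 l * x 2 5 6 (l + 3) - x 1 3 5 l * x 2 4 6 (l + 3) + x 1 3 6 l * x 2 4 5 (l + 3) + x 1 4 5 l * x 2 3 6 (l + 3)
      - x 1 4 6 l * x 2 3 5 (l + 3) + x 1 5 6 l * x 2 3 4 (l + 3) - x 2 3 4 l * x 1 5 6 (l + 3) + x 2 3 5 l * x 1 4 6 (l + 3)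
      - x 2 3 6 l * x 1 4 5 (l + 3) - x 2 4 5 l * x 1 3 6 (l + 3) + x 2 4 6 l * x 1 3 5 (l + 3) - x 2 5 6 l * x 1 3 4 (l + 3)
      + x 3 4 5 l * x 1 2 6 (l + 3) - x 3 4 6 l * x 1 2 5 (l + 3) + x 3 5 6 l * x 1 2 4 (l + 3) - x 4 5 6 l * x 1 2 3 (l + 3)"
  have L: "(\<Sum>\<sigma> | \<sigma> permutes {1..6}. of_int (sign \<sigma>) * (x (\<sigma> 1) (\<sigma> 2) (\<sigma> 3) l * x (\<sigma> 4) (\<sigma> 5) (\<sigma> 6) (l + 3))) =
      36 * ?S l" for l
    unfolding x_def by (rule laplace_3_3[of "\<lambda>i j k. xi scale \<Omega> v \<theta> i j k l" "\<lambda>i j k. xi scale \<Omega> v \<theta> i j k (l + 3)"])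
      (rule xi_swap[OF assms(1)])+
  have "I2 scale \<Omega> v \<theta> = - (1 / 3) * (\<Sum>l\<in>{1, 2, 3}. 36 * ?S l)"
    unfolding I2_def Icc13 mult.assoc by (simp only: L[unfolded x_def] x_def)
  also have "\<dots> = - (1 / 3) * (36 * (\<Sum>l\<in>{1, 2, 3}. ?S l))"
    by (simp only: sum_distrib_left)
  also have "- (1 / 3) * (36 * z) = - 12 * z" for z :: 'f
    by simp
  finally show ?thesis .
qed

lemma I2_sec: "I2 scale \<Omega> v (sec s t) = 120 * t - 288 * s"
  unfolding I2_laplace[OF sec_form]
  by (simp add: xi_quad[OF sec_form, unfolded One_nat_def] quad_def sec_eval)

text \<open>Only the monomials 145, 235 and 356 contain a conjugate pair of indices. The
  contributions of 145 and 356 cancel, which leaves that of 235.\<close>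

lemma vtheta_sec: "vtheta \<Omega> (sec s t) = scale (1 / 6) (v 6)"
proof (rule co_eqI)
  fix i :: nat assume "i \<in> {1..6}"
  then show "co i (vtheta \<Omega> (sec s t)) = co i (scale (1 / 6) (v 6))"
    by (rule Icc16_cases)
      (simp_all add: co_vtheta[OF sec_form, unfolded One_nat_def] contraction_def sec_eval)
qed

text \<open>The polynomial is x^2 (x^2 - t/36)^2. The entries enter as equations, which separates
  their evaluation from the expansion.\<close>

lemma det_sec:
  fixes C :: "'f poly mat"
  assumes "C \<in> carrier_mat 6 6"
    and E: "C $$ (0, 0) = [:0, 1:]" "C $$ (0, 1) = 0" "C $$ (0, 2) = 0"
    "C $$ (0, 3) = 0" "C $$ (0, 4) = [:t / 6:]" "C $$ (0, 5) = 0"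
    "C $$ (1, 0) = 0" "C $$ (1, 1) = [:0, 1:]" "C $$ (1, 2) = [:- 1 / 6:]"
    "C $$ (1, 3) = [:- t / 6:]" "C $$ (1, 4) = 0" "C $$ (1, 5) = 0"
    "C $$ (2, 0) = 0" "C $$ (2, 1) = 0" "C $$ (2, 2) = [:0, 1:]"
    "C $$ (2, 3) = 0" "C $$ (2, 4) = 0" "C $$ (2, 5) = 0"
    "C $$ (3, 0) = 0" "C $$ (3, 1) = [:- 1 / 6:]" "C $$ (3, 2) = 0"
    "C $$ (3, 3) = [:0, 1:]" "C $$ (3, 4) = 0" "C $$ (3, 5) = 0"
    "C $$ (4, 0) = [:1 / 6:]" "C $$ (4, 1) = 0" "C $$ (4, 2) = 0"
    "C $$ (4, 3) = 0" "C $$ (4, 4) = [:0, 1:]" "C $$ (4, 5) = 0"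
    "C $$ (5, 0) = 0" "C $$ (5, 1) = 0" "C $$ (5, 2) = 0"
    "C $$ (5, 3) = 0" "C $$ (5, 4) = [:- 1 / 6:]" "C $$ (5, 5) = [:0, 1:]"
  shows "det C = [:0, 0, t^2 / 1296, 0, - t / 18, 0, 1:]"
  unfolding det6[OF assms(1)]
  \<comment> \<open>The pruning test in \<open>det_eval\<close> must decide whether the entries
    involving \<open>t\<close> vanish.\<close>
  by (cases "t = 0") (simp_all add: det_eval E[unfolded One_nat_def] transpose_def power2_eq_square
      cong: det_rows_cong det_step_cong)

lemma I1_sec: "I1 scale \<Omega> v (sec s t) = t"
proof -
  let ?M = "endo (Lmap scale \<Omega> (sec s t))"
  have M: "?M \<in> carrier_mat 6 6" by (simp add: endo_matrix_def)
  have L: "co i (Lmap scale \<Omega> (sec s t) x) = 1 / 6 * co i (Jmap scale \<Omega> (sec s t) (v 6) x)" for i x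
    by (simp add: Lmap_def vtheta_sec Jmap_add[OF sec_form])
  have C: "char_poly_matrix ?M $$ (i, j) =
      (if i = j then [:0, 1:] else 0) + [:- (1 / 6 * co (Suc i) (Jmap scale \<Omega> (sec s t) (v 6) (v (Suc j)))):]"
    if "i < 6" "j < 6" for i j
    using that by (simp add: char_poly_matrix_def endo_matrix_def L)
  let ?C = "char_poly_matrix ?M"
  have E: "?C $$ (0, 0) = [:0, 1:]" "?C $$ (0, 1) = 0" "?C $$ (0, 2) = 0"
    "?C $$ (0, 3) = 0" "?C $$ (0, 4) = [:t / 6:]" "?C $$ (0, 5) = 0"
    "?C $$ (1, 0) = 0" "?C $$ (1, 1) = [:0, 1:]" "?C $$ (1, 2) = [:- 1 / 6:]"
    "?C $$ (1, 3) = [:- t / 6:]" "?C $$ (1, 4) = 0" "?C $$ (1, 5) = 0"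
    "?C $$ (2, 0) = 0" "?C $$ (2, 1) = 0" "?C $$ (2, 2) = [:0, 1:]"
    "?C $$ (2, 3) = 0" "?C $$ (2, 4) = 0" "?C $$ (2, 5) = 0"
    "?C $$ (3, 0) = 0" "?C $$ (3, 1) = [:- 1 / 6:]" "?C $$ (3, 2) = 0"
    "?C $$ (3, 3) = [:0, 1:]" "?C $$ (3, 4) = 0" "?C $$ (3, 5) = 0"
    "?C $$ (4, 0) = [:1 / 6:]" "?C $$ (4, 1) = 0" "?C $$ (4, 2) = 0"
    "?C $$ (4, 3) = 0" "?C $$ (4, 4) = [:0, 1:]" "?C $$ (4, 5) = 0"
    "?C $$ (5, 0) = 0" "?C $$ (5, 1) = 0" "?C $$ (5, 2) = 0"
    "?C $$ (5, 3) = 0" "?C $$ (5, 4) = [:- 1 / 6:]" "?C $$ (5, 5) = [:0, 1:]"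
    by (simp_all add: C co_Jmap[OF sec_form, unfolded One_nat_def] sec_eval numeral_2_eq_2[symmetric])
  have "char_poly ?M = [:0, 0, t^2 / 1296, 0, - t / 18, 0, 1:]"
    unfolding char_poly_def by (rule det_sec[OF char_poly_matrix_closed[OF M] E])
  then show ?thesis
    by (simp add: I1_def coeff_pCons numeral_eq_Suc)
qed


section \<open>Generators of the invariant ring\<close>

abbreviation invariant_algebra :: "(('v \<Rightarrow> 'v \<Rightarrow> 'v \<Rightarrow> 'f) \<Rightarrow> 'f) set"
  where "invariant_algebra \<equiv> generated_algebra X {I1 scale \<Omega> v, I2 scale \<Omega> v}"

lemma invariantI:
  assumes "F \<in> polynomial_functions scale"
    and "\<And>\<theta> A. \<theta> \<in> X \<Longrightarrow> A \<in> Sp scale \<Omega> \<Longrightarrow> F (act A \<theta>) = F \<theta>"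
  shows "F \<in> invariant_polynomials scale \<Omega>"
  using assms unfolding invariant_polynomials_def by blast

lemma invariantD:
  assumes "F \<in> invariant_polynomials scale \<Omega>"
  shows "F \<in> polynomial_functions scale"
    and "\<And>\<theta> A. \<theta> \<in> X \<Longrightarrow> A \<in> Sp scale \<Omega> \<Longrightarrow> F (act A \<theta>) = F \<theta>"
  using assms unfolding invariant_polynomials_def by blast+

lemma generated_subset_invariant: "invariant_algebra \<subseteq> invariant_polynomials scale \<Omega>"
proof
  fix F assume "F \<in> invariant_algebra"
  then show "F \<in> invariant_polynomials scale \<Omega>"
  proof (induction rule: generated_algebra.induct)
    case (const c)
    show ?case
      by (rule invariantI[OF poly_const]) (simp add: act_form)
  next
    case (gen F)
    then have "restrict F X \<in> polynomial_functions scale"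
      using polyn_I1 polyn_I2 by (auto simp only: polyn_def)
    moreover have "restrict F X (act A \<theta>) = restrict F X \<theta>" if "\<theta> \<in> X" "A \<in> Sp scale \<Omega>" for A \<theta>
      using gen that by (auto simp: act_form I1_act I2_act)
    ultimately show ?case
      by (rule invariantI)
  next
    case (add F G)
    show ?case
      by (rule invariantI[OF poly_add[OF add.IH[THEN invariantD(1)]]])
        (simp add: act_form add.IH[THEN invariantD(2)])
  next
    case (mult F G)
    show ?case
      by (rule invariantI[OF poly_mult[OF mult.IH[THEN invariantD(1)]]])
        (simp add: act_form mult.IH[THEN invariantD(2)])
  qed
qed

lemma coordinate_on_section:
  "\<exists>H\<in>invariant_algebra. \<forall>s t. H (sec s t) = a + s * b + t * c"
proof -
  let ?I1 = "restrict (I1 scale \<Omega> v) X" and ?I2 = "restrict (I2 scale \<Omega> v) X"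
  \<comment> \<open>Solving the values on the plane gives \<open>t = I1\<close> and
    \<open>s = (120 * I1 - I2) / 288\<close>, which is substituted into the affine function.\<close>
  let ?H = "\<lambda>\<theta>\<in>X. (\<lambda>\<theta>\<in>X. a) \<theta> + (\<lambda>\<theta>\<in>X. (\<lambda>\<theta>\<in>X. (\<lambda>\<theta>\<in>X. c + 120 / 288 * b) \<theta> * ?I1 \<theta>) \<theta> +
    (\<lambda>\<theta>\<in>X. (\<lambda>\<theta>\<in>X. - b / 288) \<theta> * ?I2 \<theta>) \<theta>) \<theta>"
  have "?H \<in> invariant_algebra"
    by (intro generated_algebra.add generated_algebra.mult generated_algebra.const generated_algebra.gen) auto
  moreover have "?H (sec s t) = a + s * b + t * c" for s t
    by (simp add: sec_form I1_sec I2_sec field_simps)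
  ultimately show ?thesis by blast
qed

text \<open>Restriction to the plane respects sums and products, and a linear functional restricts
  to an affine function of \<open>s\<close> and \<open>t\<close>, which
  \<open>coordinate_on_section\<close> matches.\<close>

lemma polynomial_on_section:
  assumes "F \<in> polynomial_functions scale"
  shows "\<exists>H\<in>invariant_algebra. \<forall>s t. F (sec s t) = H (sec s t)"
  using assms unfolding polynomial_functions_def
proof (induction rule: generated_algebra.induct)
  case (const c)
  show ?case by (intro bexI[OF _ generated_algebra.const[where c = c]] allI refl)
next
  case (gen \<phi>)
  note \<phi> = linear_functional_shift[OF gen]
  have eq: "restrict \<phi> X (sec s t) = \<phi> (sec 0 0) + s * \<phi> (mono 2 3 4) + t * \<phi> (mono 4 5 6)" for s t
  proof -
    have "\<phi> (sec s t) = \<phi> (shift (shift (sec 0 0) (mono 2 3 4) s) (mono 4 5 6) t)"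
      by (simp add: sec_shift)
    also have "\<dots> = \<phi> (sec 0 0) + s * \<phi> (mono 2 3 4) + t * \<phi> (mono 4 5 6)"
      by (simp only: sec_form shift_form mono_form \<phi>)
    finally show ?thesis by (simp only: restrict_apply sec_form if_True)
  qed
  obtain H where "H \<in> invariant_algebra"
    "\<forall>s t. H (sec s t) = \<phi> (sec 0 0) + s * \<phi> (mono 2 3 4) + t * \<phi> (mono 4 5 6)"
    using coordinate_on_section[of "\<phi> (sec 0 0)" "\<phi> (mono 2 3 4)" "\<phi> (mono 4 5 6)"] by (elim bexE)
  then show ?case
    by (intro bexI[of _ H] allI) (simp_all only: eq)
next
  case (add F G)
  then obtain H K where "H \<in> invariant_algebra" "K \<in> invariant_algebra"
    "\<forall>s t. F (sec s t) = H (sec s t)" "\<forall>s t. G (sec s t) = K (sec s t)"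
    by blast
  then show ?case
    by (intro bexI[OF _ generated_algebra.add[of H _ _ K]] allI) (simp_all only: restrict_apply sec_form if_True)
next
  case (mult F G)
  then obtain H K where "H \<in> invariant_algebra" "K \<in> invariant_algebra"
    "\<forall>s t. F (sec s t) = H (sec s t)" "\<forall>s t. G (sec s t) = K (sec s t)"
    by blast
  then show ?case
    by (intro bexI[OF _ generated_algebra.mult[of H _ _ K]] allI) (simp_all only: restrict_apply sec_form if_True)
qed

lemma polynomial_extensional:
  assumes "F \<in> polynomial_functions scale" "\<theta> \<notin> X"
  shows "F \<theta> = undefined"
  using assms unfolding polynomial_functions_def by (cases rule: generated_algebra.cases) auto

lemma invariant_subset_generated: "invariant_polynomials scale \<Omega> \<subseteq> invariant_algebra"
proof
  fix F assume F: "F \<in> invariant_polynomials scale \<Omega>"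
  then have FP: "F \<in> polynomial_functions scale"
    by (simp add: invariant_polynomials_def)
  obtain H where H: "H \<in> invariant_algebra" "\<And>s t. F (sec s t) = H (sec s t)"
    using polynomial_on_section[OF FP] by blast
  have HI: "H \<in> invariant_polynomials scale \<Omega>"
    using H(1) generated_subset_invariant by blast
  then have HP: "H \<in> polynomial_functions scale"
    by (simp add: invariant_polynomials_def)
  \<comment> \<open>The difference of \<open>F\<close> and \<open>H\<close>, assembled from
    restricted sums and products so that \<open>poly_add\<close> and \<open>poly_mult\<close>
    apply.\<close>
  let ?D = "\<lambda>\<theta>\<in>X. F \<theta> + (\<lambda>\<theta>\<in>X. (\<lambda>\<theta>\<in>X. - 1) \<theta> * H \<theta>) \<theta>"
  have "vanishing ?D"
    unfolding vanishing_def
  proof (intro conjI ballI allI)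
    show "?D \<in> polynomial_functions scale"
      by (intro poly_add poly_mult poly_const FP HP)
    show "?D (act A (sec s t)) = 0" if "A \<in> Sp scale \<Omega>" for A s t
      using F HI that H(2)[of s t] by (simp add: invariant_polynomials_def act_form sec_form)
  qed
  then have "F \<theta> = H \<theta>" if "\<theta> \<in> X" for \<theta>
    using vanishing_imp_zero[of ?D \<theta>] that by simp
  \<comment> \<open>Off the space of 3-forms both functions are \<open>undefined\<close>, so
    agreement on it is equality.\<close>
  then have "F = H"
    using polynomial_extensional FP HP by (metis ext)
  with H(1) show "F \<in> invariant_algebra" by simp
qed

end

theorem corollary3p4:
  fixes scale :: "'f::{alg_closed_field, field_char_0} \<Rightarrow> 'v::ab_group_add \<Rightarrow> 'v"
    and \<Omega> :: "'v \<Rightarrow> 'v \<Rightarrow> 'f"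
    and v :: "nat \<Rightarrow> 'v"
  assumes "vector_space scale"
    and "vector_space.dim scale (UNIV :: 'v set) = 6"
    and "alternating_bilinear scale (*) \<Omega>"
    and "nondegenerate \<Omega>"
    and "symplectic_basis scale \<Omega> v"
  shows "invariant_polynomials scale \<Omega> =
    generated_algebra (three_forms scale) {I1 scale \<Omega> v, I2 scale \<Omega> v}"
proof -
  interpret symplectic_space scale \<Omega> v
    using assms(1,5) by (simp add: symplectic_space_def symplectic_space_axioms_def)
  show ?thesis
    by (rule equalityI[OF invariant_subset_generated generated_subset_invariant])
qed

end
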